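(* Let $\mathcal{C}$ be a congruence-modular equational class, let $A,B$ be members of $\mathcal{C}$ and let $f:A\to B$ be an admissible morphism in $\mathcal{C}$. If the congruence $\nabla_B$ of $B$ is finitely generated and $f$ fulfills GU, then $f$ fulfills LO. The converse is not true: there exist a congruence-modular equational class and an admissible morphism $f:A\to B$ in it, with $\nabla_B$ finitely generated, such that $f$ fulfills LO but does not fulfill GU.
   Context: An equational class (variety) $\mathcal{C}$ of algebras of a fixed type is congruence-modular if the congruence lattice $\mathrm{Con}(M)$ is modular for every member $M$ of $\mathcal{C}$. All algebras are non-empty; a morphism in $\mathcal{C}$ is a homomorphism between members of $\mathcal{C}$. For an algebra $M$, $\Delta_M$ is the equality relation and $\nabla_M=M^2$; a congruence is finitely generated if it is the least congruence containing some finite subset of $M^2$. In a congruence-modular class, the commutator $[\alpha,\beta]_M$ of $\alpha,\beta\in\mathrm{Con}(M)$ is the (Freese--McKenzie) modular commutator, i.e. the smallest congruence $\delta$ of $M$ such that, for every term $t(\bar x,\bar y)$ and all tuples $\bar a,\bar b,\bar c,\bar d$ of elements of $M$ with $(a_i,b_i)\in\alpha$ for all $i$ and $(c_j,d_j)\in\beta$ for all $j$, $(t(\bar a,\bar c),t(\bar a,\bar d))\in\delta$ implies $(t(\bar b,\bar c),t(\bar b,\bar d))\in\delta$. A congruence $\phi\neq\nabla_M$ is prime if, for all $\alpha,\beta\in\mathrm{Con}(M)$, $[\alpha,\beta]_M\subseteq\phi$ implies $\alpha\subseteq\phi$ or $\beta\subseteq\phi$; $\mathrm{Spec}(M)$ is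 the set of prime congruences of $M$. For a morphism $f:A\to B$ and $\psi\in\mathrm{Con}(B)$, $f^*(\psi)=\{(x,y)\in A^2 : (f(x),f(y))\in\psi\}\in\mathrm{Con}(A)$ and $\mathrm{Ker}(f)=f^*(\Delta_B)$. $f$ is admissible if $f^*(\psi)\in\mathrm{Spec}(A)$ for all $\psi\in\mathrm{Spec}(B)$. An admissible morphism $f:A\to B$ fulfills GU (Going Up) if for all $\phi,\psi\in\mathrm{Spec}(A)$ and $\phi_1\in\mathrm{Spec}(B)$ with $\phi\subseteq\psi$ and $f^*(\phi_1)=\phi$ there is $\psi_1\in\mathrm{Spec}(B)$ with $\phi_1\subseteq\psi_1$ and $f^*(\psi_1)=\psi$; it fulfills LO (Lying Over) if for every $\phi\in\mathrm{Spec}(A)$ with $\mathrm{Ker}(f)\subseteq\phi$ there is $\phi_1\in\mathrm{Spec}(B)$ with $f^*(\phi_1)=\phi$. *)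

theory Defs
  imports Main
begin

section \<open>Universal algebra\<close>

text \<open>
  A type of algebras is a set of pairs \<open>(s, n)\<close>, read as ``\<open>s\<close> is an \<open>n\<close>-ary operation symbol''.
  The interpretation of \<open>s\<close> takes the list of its arguments; its values matter only for lists of
  elements of the universe whose length is an arity of \<open>s\<close>.
\<close>

type_synonym 'f signature = "('f \<times> nat) set"

datatype ('f, 'v) trm = Var 'v | App 'f "('f, 'v) trm list"

record ('f, 'a) algebra =
  univ :: "'a set"
  opn :: "'f \<Rightarrow> 'a list \<Rightarrow> 'a"

inductive_set wf_terms :: "'f signature \<Rightarrow> ('f, 'v) trm set" for S :: "'f signature" where
  Var: "Var v \<in> wf_terms S"
| App: "\<lbrakk>(s, length ts) \<in> S; \<And>t. t \<in> set ts \<Longrightarrow> t \<in> wf_terms S\<rbrakk> \<Longrightarrow> App s ts \<in> wf_terms S"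

fun eval :: "('f, 'a) algebra \<Rightarrow> ('v \<Rightarrow> 'a) \<Rightarrow> ('f, 'v) trm \<Rightarrow> 'a" where
  "eval M g (Var v) = g v"
| "eval M g (App s ts) = opn M s (map (eval M g) ts)"

definition is_algebra :: "'f signature \<Rightarrow> ('f, 'a) algebra \<Rightarrow> bool" where
  "is_algebra S M \<longleftrightarrow> univ M \<noteq> {} \<and>
     (\<forall>(s, n) \<in> S. \<forall>xs. length xs = n \<and> set xs \<subseteq> univ M \<longrightarrow> opn M s xs \<in> univ M)"

type_synonym 'f identities = "(('f, nat) trm \<times> ('f, nat) trm) set"

definition is_identities :: "'f signature \<Rightarrow> 'f identities \<Rightarrow> bool" where
  "is_identities S E \<longleftrightarrow> E \<subseteq> wf_terms S \<times> wf_terms S"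

text \<open>The members, with elements in the type \<open>'a\<close>, of the equational class axiomatised by \<open>E\<close>.\<close>

definition members :: "'f signature \<Rightarrow> 'f identities \<Rightarrow> ('f, 'a) algebra set" where
  "members S E = {M. is_algebra S M \<and>
     (\<forall>(l, r) \<in> E. \<forall>g. range g \<subseteq> univ M \<longrightarrow> eval M g l = eval M g r)}"

definition is_hom ::
  "'f signature \<Rightarrow> ('f, 'a) algebra \<Rightarrow> ('f, 'b) algebra \<Rightarrow> ('a \<Rightarrow> 'b) \<Rightarrow> bool" where
  "is_hom S A B f \<longleftrightarrow> f ` univ A \<subseteq> univ B \<and>
     (\<forall>(s, n) \<in> S. \<forall>xs. length xs = n \<and> set xs \<subseteq> univ A \<longrightarrow>
        f (opn A s xs) = opn B s (map f xs))"

section \<open>Congruences\<close>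

definition Con :: "'f signature \<Rightarrow> ('f, 'a) algebra \<Rightarrow> 'a rel set" where
  "Con S M = {\<theta>. equiv (univ M) \<theta> \<and>
     (\<forall>(s, n) \<in> S. \<forall>xs ys. length xs = n \<and> list_all2 (\<lambda>x y. (x, y) \<in> \<theta>) xs ys \<longrightarrow>
        (opn M s xs, opn M s ys) \<in> \<theta>)}"

definition Delta :: "('f, 'a) algebra \<Rightarrow> 'a rel" where
  "Delta M = Id_on (univ M)"

definition Nabla :: "('f, 'a) algebra \<Rightarrow> 'a rel" where
  "Nabla M = univ M \<times> univ M"

text \<open>The least congruence containing \<open>X\<close> (for \<open>X \<subseteq> Nabla M\<close>); see \<open>Cg_in_Con\<close> to \<open>Cg_least\<close>.\<close>

definition Cg :: "'f signature \<Rightarrow> ('f, 'a) algebra \<Rightarrow> 'a rel \<Rightarrow> 'a rel" where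
  "Cg S M X = \<Inter> {\<theta> \<in> Con S M. X \<subseteq> \<theta>}"

definition finitely_generated :: "'f signature \<Rightarrow> ('f, 'a) algebra \<Rightarrow> 'a rel \<Rightarrow> bool" where
  "finitely_generated S M \<theta> \<longleftrightarrow> (\<exists>X. finite X \<and> X \<subseteq> Nabla M \<and> \<theta> = Cg S M X)"

text \<open>
  In the lattice \<open>Con S M\<close>, ordered by inclusion, the meet is the intersection and the join of
  \<open>\<alpha>\<close> and \<open>\<beta>\<close> is \<open>Cg S M (\<alpha> \<union> \<beta>)\<close>.
\<close>

definition modular_Con :: "'f signature \<Rightarrow> ('f, 'a) algebra \<Rightarrow> bool" where
  "modular_Con S M \<longleftrightarrow> (\<forall>\<alpha> \<in> Con S M. \<forall>\<beta> \<in> Con S M. \<forall>\<gamma> \<in> Con S M. \<alpha> \<subseteq> \<gamma> \<longrightarrow>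
     Cg S M (\<alpha> \<union> (\<beta> \<inter> \<gamma>)) = Cg S M (\<alpha> \<union> \<beta>) \<inter> \<gamma>)"

text \<open>
  A definition cannot quantify over all types of elements. It is enough to consider the members
  with elements in \<open>('f, nat) trm\<close>: theorem \<open>congruence_modular_modular_Con\<close> below shows that
  then \<open>Con S M\<close> is modular for every member \<open>M\<close>, whatever the type of its elements.
\<close>

definition congruence_modular :: "'f signature \<Rightarrow> 'f identities \<Rightarrow> bool" where
  "congruence_modular S E \<longleftrightarrow>
     (\<forall>M :: ('f, ('f, nat) trm) algebra. M \<in> members S E \<longrightarrow> modular_Con S M)"

section \<open>The commutator and prime congruences\<close>

text \<open>
  \<open>term_condition S M \<alpha> \<beta> \<delta>\<close>: the terms \<open>t(x, y)\<close> have the variables \<open>Inl i\<close> for \<open>x\<close> and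
  \<open>Inr j\<close> for \<open>y\<close>. The tuples are given by infinite sequences, of which a term uses only
  finitely many entries; finite tuples can be prolonged, since universes are non-empty.
\<close>

definition term_condition ::
  "'f signature \<Rightarrow> ('f, 'a) algebra \<Rightarrow> 'a rel \<Rightarrow> 'a rel \<Rightarrow> 'a rel \<Rightarrow> bool" where
  "term_condition S M \<alpha> \<beta> \<delta> \<longleftrightarrow>
     (\<forall>t \<in> (wf_terms S :: ('f, nat + nat) trm set). \<forall>a b c d.
        (\<forall>i. (a i, b i) \<in> \<alpha>) \<and> (\<forall>j. (c j, d j) \<in> \<beta>) \<longrightarrow>
        (eval M (case_sum a c) t, eval M (case_sum a d) t) \<in> \<delta> \<longrightarrow>
        (eval M (case_sum b c) t, eval M (case_sum b d) t) \<in> \<delta>)"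

text \<open>The smallest such congruence; see \<open>commutator_in_Con\<close> to \<open>commutator_least\<close>.\<close>

definition commutator ::
  "'f signature \<Rightarrow> ('f, 'a) algebra \<Rightarrow> 'a rel \<Rightarrow> 'a rel \<Rightarrow> 'a rel" where
  "commutator S M \<alpha> \<beta> = \<Inter> {\<delta> \<in> Con S M. term_condition S M \<alpha> \<beta> \<delta>}"

definition prime_congruence :: "'f signature \<Rightarrow> ('f, 'a) algebra \<Rightarrow> 'a rel \<Rightarrow> bool" where
  "prime_congruence S M \<phi> \<longleftrightarrow> \<phi> \<in> Con S M \<and> \<phi> \<noteq> Nabla M \<and>
     (\<forall>\<alpha> \<in> Con S M. \<forall>\<beta> \<in> Con S M. commutator S M \<alpha> \<beta> \<subseteq> \<phi> \<longrightarrow> \<alpha> \<subseteq> \<phi> \<or> \<beta> \<subseteq> \<phi>)"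

definition Spec :: "'f signature \<Rightarrow> ('f, 'a) algebra \<Rightarrow> 'a rel set" where
  "Spec S M = {\<phi>. prime_congruence S M \<phi>}"

section \<open>Admissible morphisms, Going Up and Lying Over\<close>

definition pullback :: "('f, 'a) algebra \<Rightarrow> ('a \<Rightarrow> 'b) \<Rightarrow> 'b rel \<Rightarrow> 'a rel" where
  "pullback A f \<psi> = {(x, y) \<in> univ A \<times> univ A. (f x, f y) \<in> \<psi>}"

definition Ker :: "('f, 'a) algebra \<Rightarrow> ('f, 'b) algebra \<Rightarrow> ('a \<Rightarrow> 'b) \<Rightarrow> 'a rel" where
  "Ker A B f = pullback A f (Delta B)"

definition admissible ::
  "'f signature \<Rightarrow> ('f, 'a) algebra \<Rightarrow> ('f, 'b) algebra \<Rightarrow> ('a \<Rightarrow> 'b) \<Rightarrow> bool" where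
  "admissible S A B f \<longleftrightarrow> is_hom S A B f \<and> (\<forall>\<psi> \<in> Spec S B. pullback A f \<psi> \<in> Spec S A)"

definition fulfills_GU ::
  "'f signature \<Rightarrow> ('f, 'a) algebra \<Rightarrow> ('f, 'b) algebra \<Rightarrow> ('a \<Rightarrow> 'b) \<Rightarrow> bool" where
  "fulfills_GU S A B f \<longleftrightarrow>
     (\<forall>\<phi> \<in> Spec S A. \<forall>\<psi> \<in> Spec S A. \<forall>\<phi>\<^sub>1 \<in> Spec S B. \<phi> \<subseteq> \<psi> \<and> pullback A f \<phi>\<^sub>1 = \<phi> \<longrightarrow>
        (\<exists>\<psi>\<^sub>1 \<in> Spec S B. \<phi>\<^sub>1 \<subseteq> \<psi>\<^sub>1 \<and> pullback A f \<psi>\<^sub>1 = \<psi>))"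

definition fulfills_LO ::
  "'f signature \<Rightarrow> ('f, 'a) algebra \<Rightarrow> ('f, 'b) algebra \<Rightarrow> ('a \<Rightarrow> 'b) \<Rightarrow> bool" where
  "fulfills_LO S A B f \<longleftrightarrow>
     (\<forall>\<phi> \<in> Spec S A. Ker A B f \<subseteq> \<phi> \<longrightarrow> (\<exists>\<phi>\<^sub>1 \<in> Spec S B. pullback A f \<phi>\<^sub>1 = \<phi>))"

section \<open>Adequacy of the definitions\<close>

lemma Con_equiv: "\<theta> \<in> Con S M \<Longrightarrow> equiv (univ M) \<theta>"
  by (simp add: Con_def)

lemma Con_subset: "\<theta> \<in> Con S M \<Longrightarrow> \<theta> \<subseteq> univ M \<times> univ M"
  by (auto simp: Con_def equiv_def)

lemma Con_refl: "\<theta> \<in> Con S M \<Longrightarrow> x \<in> univ M \<Longrightarrow> (x, x) \<in> \<theta>"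
  by (auto simp: Con_def equiv_def refl_on_def)

lemma Con_sym: "\<theta> \<in> Con S M \<Longrightarrow> (x, y) \<in> \<theta> \<Longrightarrow> (y, x) \<in> \<theta>"
  by (auto simp: Con_def equiv_def dest: symD)

lemma Con_trans: "\<theta> \<in> Con S M \<Longrightarrow> (x, y) \<in> \<theta> \<Longrightarrow> (y, z) \<in> \<theta> \<Longrightarrow> (x, z) \<in> \<theta>"
  by (auto simp: Con_def equiv_def dest: transD)

lemma Con_opn:
  "\<theta> \<in> Con S M \<Longrightarrow> (s, length xs) \<in> S \<Longrightarrow> list_all2 (\<lambda>x y. (x, y) \<in> \<theta>) xs ys \<Longrightarrow>
   (opn M s xs, opn M s ys) \<in> \<theta>"
  by (fastforce simp: Con_def)

lemma Con_I:
  assumes "\<theta> \<subseteq> univ M \<times> univ M"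
    and "\<And>x. x \<in> univ M \<Longrightarrow> (x, x) \<in> \<theta>"
    and "\<And>x y. (x, y) \<in> \<theta> \<Longrightarrow> (y, x) \<in> \<theta>"
    and "\<And>x y z. (x, y) \<in> \<theta> \<Longrightarrow> (y, z) \<in> \<theta> \<Longrightarrow> (x, z) \<in> \<theta>"
    and "\<And>s xs ys. (s, length xs) \<in> S \<Longrightarrow> list_all2 (\<lambda>x y. (x, y) \<in> \<theta>) xs ys \<Longrightarrow>
           (opn M s xs, opn M s ys) \<in> \<theta>"
  shows "\<theta> \<in> Con S M"
proof -
  have "equiv (univ M) \<theta>"
    using assms(1,2,3) assms(4) by (intro equivI refl_onI symI transI) blast+
  then show ?thesis using assms(5) by (auto simp: Con_def)
qed

lemma is_algebra_opn:
  "is_algebra S M \<Longrightarrow> (s, length xs) \<in> S \<Longrightarrow> set xs \<subseteq> univ M \<Longrightarrow> opn M s xs \<in> univ M"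
  by (fastforce simp: is_algebra_def)

lemma is_hom_opn:
  "is_hom S A B f \<Longrightarrow> (s, length xs) \<in> S \<Longrightarrow> set xs \<subseteq> univ A \<Longrightarrow>
   f (opn A s xs) = opn B s (map f xs)"
  by (fastforce simp: is_hom_def)

lemma list_all2_in_sets:
  assumes "list_all2 (\<lambda>x y. (x, y) \<in> \<theta>) xs ys" "\<theta> \<subseteq> U \<times> U"
  shows "set xs \<subseteq> U" "set ys \<subseteq> U"
  using assms by (induction rule: list_all2_induct) auto

lemma Nabla_in_Con:
  assumes "is_algebra S M" shows "Nabla M \<in> Con S M"
proof (rule Con_I)
  fix s xs ys
  assume *: "(s, length xs) \<in> S" "list_all2 (\<lambda>x y. (x, y) \<in> Nabla M) xs ys"
  have "set xs \<subseteq> univ M" "set ys \<subseteq> univ M"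
    using list_all2_in_sets[OF *(2), of "univ M"] by (auto simp: Nabla_def)
  then show "(opn M s xs, opn M s ys) \<in> Nabla M"
    using is_algebra_opn[OF assms] * list_all2_lengthD[OF *(2)] by (simp add: Nabla_def)
qed (auto simp: Nabla_def)

lemma Inter_in_Con:
  assumes "F \<subseteq> Con S M" "F \<noteq> {}" shows "\<Inter> F \<in> Con S M"
proof (rule Con_I)
  have F: "\<theta> \<in> Con S M" if "\<theta> \<in> F" for \<theta> using that assms(1) by blast
  show "\<Inter> F \<subseteq> univ M \<times> univ M" using assms(2) F Con_subset by fast
  show "(x, x) \<in> \<Inter> F" if "x \<in> univ M" for x using that Con_refl[OF F] by blast
  show "(y, x) \<in> \<Inter> F" if "(x, y) \<in> \<Inter> F" for x y using that Con_sym[OF F] by blast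
  show "(x, z) \<in> \<Inter> F" if "(x, y) \<in> \<Inter> F" "(y, z) \<in> \<Inter> F" for x y z
    using that Con_trans[OF F] by blast
  show "(opn M s xs, opn M s ys) \<in> \<Inter> F"
    if "(s, length xs) \<in> S" "list_all2 (\<lambda>x y. (x, y) \<in> \<Inter> F) xs ys" for s xs ys
  proof
    fix \<theta> assume "\<theta> \<in> F"
    then have "list_all2 (\<lambda>x y. (x, y) \<in> \<theta>) xs ys"
      using that(2) by (auto elim: list_all2_mono)
    then show "(opn M s xs, opn M s ys) \<in> \<theta>"
      using Con_opn[OF F[OF \<open>\<theta> \<in> F\<close>] that(1)] by blast
  qed
qed

lemma Cg_in_Con:
  assumes "is_algebra S M" "X \<subseteq> Nabla M" shows "Cg S M X \<in> Con S M"
  unfolding Cg_def using Nabla_in_Con[OF assms(1)] assms(2) by (intro Inter_in_Con) auto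

lemma Cg_extensive: "X \<subseteq> Cg S M X"
  by (auto simp: Cg_def)

lemma Cg_least: "\<theta> \<in> Con S M \<Longrightarrow> X \<subseteq> \<theta> \<Longrightarrow> Cg S M X \<subseteq> \<theta>"
  by (auto simp: Cg_def)

lemma eval_closed:
  assumes "is_algebra S M" "t \<in> wf_terms S" "range g \<subseteq> univ M"
  shows "eval M g t \<in> univ M"
  using assms(2)
proof (induction rule: wf_terms.induct)
  case (Var v) then show ?case using assms(3) by auto
next
  case (App s ts)
  then show ?case using is_algebra_opn[OF assms(1), of s "map (eval M g) ts"] by auto
qed

lemma term_condition_Nabla:
  assumes "is_algebra S M" "\<alpha> \<in> Con S M" "\<beta> \<in> Con S M"
  shows "term_condition S M \<alpha> \<beta> (Nabla M)"
  unfolding term_condition_def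
proof (intro ballI allI impI)
  fix t :: "('a, nat + nat) trm" and a b c d :: "nat \<Rightarrow> 'b"
  assume t: "t \<in> wf_terms S" and *: "(\<forall>i. (a i, b i) \<in> \<alpha>) \<and> (\<forall>j. (c j, d j) \<in> \<beta>)"
  have "b i \<in> univ M" "c i \<in> univ M" "d i \<in> univ M" for i
    using * Con_subset[OF assms(2)] Con_subset[OF assms(3)] by auto
  then have "range (case_sum b c) \<subseteq> univ M" "range (case_sum b d) \<subseteq> univ M"
    by (auto split: sum.splits)
  then show "(eval M (case_sum b c) t, eval M (case_sum b d) t) \<in> Nabla M"
    using eval_closed[OF assms(1) t] by (auto simp: Nabla_def)
qed

lemma commutator_in_Con:
  assumes "is_algebra S M" "\<alpha> \<in> Con S M" "\<beta> \<in> Con S M"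
  shows "commutator S M \<alpha> \<beta> \<in> Con S M"
  unfolding commutator_def
  using Nabla_in_Con[OF assms(1)] term_condition_Nabla[OF assms] by (intro Inter_in_Con) auto

lemma commutator_term_condition: "term_condition S M \<alpha> \<beta> (commutator S M \<alpha> \<beta>)"
  unfolding commutator_def term_condition_def by blast

lemma commutator_least:
  "\<delta> \<in> Con S M \<Longrightarrow> term_condition S M \<alpha> \<beta> \<delta> \<Longrightarrow> commutator S M \<alpha> \<beta> \<subseteq> \<delta>"
  by (auto simp: commutator_def)

lemma pullback_in_Con:
  assumes A: "is_algebra S A" and f: "is_hom S A B f" and \<psi>: "\<psi> \<in> Con S B"
  shows "pullback A f \<psi> \<in> Con S A"
proof (rule Con_I)
  have fA: "f x \<in> univ B" if "x \<in> univ A" for x using f that by (auto simp: is_hom_def)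
  show "pullback A f \<psi> \<subseteq> univ A \<times> univ A" by (auto simp: pullback_def)
  then have sub: "pullback A f \<psi> \<subseteq> univ A \<times> univ A" .
  show "(x, x) \<in> pullback A f \<psi>" if "x \<in> univ A" for x
    using that fA Con_refl[OF \<psi>] by (auto simp: pullback_def)
  show "(y, x) \<in> pullback A f \<psi>" if "(x, y) \<in> pullback A f \<psi>" for x y
    using that Con_sym[OF \<psi>] by (auto simp: pullback_def)
  show "(x, z) \<in> pullback A f \<psi>"
    if "(x, y) \<in> pullback A f \<psi>" "(y, z) \<in> pullback A f \<psi>" for x y z
    using that Con_trans[OF \<psi>] by (auto simp: pullback_def)
  show "(opn A s xs, opn A s ys) \<in> pullback A f \<psi>"
    if *: "(s, length xs) \<in> S" "list_all2 (\<lambda>x y. (x, y) \<in> pullback A f \<psi>) xs ys" for s xs ys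
  proof -
    have len: "length ys = length xs" using *(2) by (simp add: list_all2_lengthD)
    have s: "set xs \<subseteq> univ A" "set ys \<subseteq> univ A"
      using list_all2_in_sets[OF *(2) sub] by auto
    have "list_all2 (\<lambda>x y. (x, y) \<in> \<psi>) (map f xs) (map f ys)"
      using *(2) by (auto simp: list_all2_map1 list_all2_map2 pullback_def elim!: list_all2_mono)
    then have "(opn B s (map f xs), opn B s (map f ys)) \<in> \<psi>"
      using Con_opn[OF \<psi>] *(1) by simp
    then show ?thesis
      using is_hom_opn[OF f] is_algebra_opn[OF A] *(1) s len by (simp add: pullback_def)
  qed
qed

lemma hom_eval:
  assumes "is_algebra S A" "is_hom S A B f" "t \<in> wf_terms S" "range g \<subseteq> univ A"
  shows "f (eval A g t) = eval B (f \<circ> g) t"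
  using assms(3)
proof (induction rule: wf_terms.induct)
  case (App s ts)
  have "set (map (eval A g) ts) \<subseteq> univ A"
    using App eval_closed[OF assms(1) _ assms(4)] by auto
  then have "f (eval A g (App s ts)) = opn B s (map f (map (eval A g) ts))"
    using is_hom_opn[OF assms(2)] App(1) by simp
  also have "map f (map (eval A g) ts) = map (eval B (f \<circ> g)) ts"
    using App by (simp add: comp_def)
  finally show ?case by (simp add: comp_def)
qed simp

lemma Con_join_trancl:
  assumes M: "is_algebra S M" and \<alpha>: "\<alpha> \<in> Con S M" and \<beta>: "\<beta> \<in> Con S M"
  shows "Cg S M (\<alpha> \<union> \<beta>) = (\<alpha> \<union> \<beta>)\<^sup>+"
proof
  let ?T = "(\<alpha> \<union> \<beta>)\<^sup>+"
  have sub: "?T \<subseteq> univ M \<times> univ M"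
    using Con_subset[OF \<alpha>] Con_subset[OF \<beta>] by (intro trancl_subset_Sigma) auto
  have refl: "(x, x) \<in> ?T" if "x \<in> univ M" for x
    using Con_refl[OF \<alpha> that] by auto
  have unary: "(opn M s (pre @ x # xs), opn M s (pre @ y # xs)) \<in> ?T"
    if T: "(x, y) \<in> ?T" and ar: "(s, length (pre @ x # xs)) \<in> S"
      and pre: "set pre \<subseteq> univ M" and xs: "set xs \<subseteq> univ M"
    for s pre x y xs
  proof -
    have unit_step: "(opn M s (pre @ u # xs), opn M s (pre @ v # xs)) \<in> \<alpha> \<union> \<beta>"
      if "(u, v) \<in> \<alpha> \<union> \<beta>" for u v
    proof -
      have *: "(opn M s (pre @ u # xs), opn M s (pre @ v # xs)) \<in> \<theta>"
        if \<theta>: "\<theta> \<in> Con S M" "(u, v) \<in> \<theta>" for \<theta>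
      proof -
        have r: "list_all2 (\<lambda>x y. (x, y) \<in> \<theta>) zs zs" if "set zs \<subseteq> univ M" for zs
          using that Con_refl[OF \<theta>(1)] by (intro list.rel_refl_strong) blast
        have "list_all2 (\<lambda>x y. (x, y) \<in> \<theta>) (pre @ u # xs) (pre @ v # xs)"
          using r[OF pre] r[OF xs] \<theta>(2) by (simp add: list_all2_appendI)
        then show ?thesis
          using Con_opn[OF \<theta>(1)] ar by simp
      qed
      show ?thesis using that *[OF \<alpha>] *[OF \<beta>] by auto
    qed
    show ?thesis
      using T
    proof (induction rule: trancl_induct)
      case (base y)
      then show ?case using unit_step by blast
    next
      case (step y z)
      then show ?case using unit_step by (meson trancl.trancl_into_trancl)
    qed
  qed
  have "?T \<in> Con S M"
  proof (rule Con_I)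
    show "(y, x) \<in> ?T" if "(x, y) \<in> ?T" for x y
    proof -
      have "sym (\<alpha> \<union> \<beta>)" using Con_sym[OF \<alpha>] Con_sym[OF \<beta>] by (auto intro: symI)
      then show ?thesis using that by (meson sym_trancl symD)
    qed
    show "(opn M s xs, opn M s ys) \<in> ?T"
      if "(s, length xs) \<in> S" "list_all2 (\<lambda>x y. (x, y) \<in> ?T) xs ys" for s xs ys
    proof -
      have "(opn M s (pre @ xs), opn M s (pre @ ys)) \<in> ?T"
        if "set pre \<subseteq> univ M" "(s, length (pre @ xs)) \<in> S" for pre
        using \<open>list_all2 _ xs ys\<close> that
      proof (induction arbitrary: pre rule: list_all2_induct)
        case Nil
        then show ?case using refl is_algebra_opn[OF M] by auto
      next
        case (Cons x xs y ys)
        have y: "x \<in> univ M" "y \<in> univ M" using Cons(1) sub by auto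
        have "set xs \<subseteq> univ M" using list_all2_in_sets[OF Cons(2) sub] by simp
        then have "(opn M s (pre @ x # xs), opn M s (pre @ y # xs)) \<in> ?T"
          using unary Cons by blast
        moreover have "(opn M s ((pre @ [y]) @ xs), opn M s ((pre @ [y]) @ ys)) \<in> ?T"
          using Cons y by (intro Cons.IH) auto
        ultimately show ?case using trancl_trans by fastforce
      qed
      from this[of "[]"] show ?thesis using that by simp
    qed
    show "(x, z) \<in> ?T" if "(x, y) \<in> ?T" "(y, z) \<in> ?T" for x y z
      using that by (rule trancl_trans)
  qed (fact sub, fact refl)
  then show "Cg S M (\<alpha> \<union> \<beta>) \<subseteq> ?T" by (intro Cg_least) auto
  have C: "Cg S M (\<alpha> \<union> \<beta>) \<in> Con S M"
    using Con_subset[OF \<alpha>] Con_subset[OF \<beta>] by (intro Cg_in_Con[OF M]) (auto simp: Nabla_def)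
  show "?T \<subseteq> Cg S M (\<alpha> \<union> \<beta>)"
  proof clarify
    fix x y assume "(x, y) \<in> ?T"
    then show "(x, y) \<in> Cg S M (\<alpha> \<union> \<beta>)"
    proof (induction rule: trancl_induct)
      case (base y) then show ?case using Cg_extensive by blast
    next
      case (step y z)
      then have "(y, z) \<in> Cg S M (\<alpha> \<union> \<beta>)" using Cg_extensive by blast
      then show ?case using step.IH Con_trans[OF C] by blast
    qed
  qed
qed

text \<open>Every countably generated subalgebra is isomorphic to an algebra of terms.\<close>

lemma countably_generated_subalgebra:
  fixes M :: "('f, 'a) algebra" and g :: "nat \<Rightarrow> 'a"
  assumes M: "M \<in> members S E" and E: "is_identities S E" and g: "range g \<subseteq> univ M"
  obtains N :: "('f, ('f, nat) trm) algebra" and h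
  where "N \<in> members S E" "is_hom S N M h" "range g \<subseteq> h ` univ N"
proof -
  define W where "W = (wf_terms S :: ('f, nat) trm set)"
  define h where "h = eval M g"
  define s where "s = inv_into W h"
  define N where "N = \<lparr>univ = s ` h ` W, opn = (\<lambda>f ts. s (opn M f (map h ts)))\<rparr>"
  have algM: "is_algebra S M" using M by (simp add: members_def)
  have hs: "h (s x) = x" "s x \<in> W" if "x \<in> h ` W" for x
    using that by (auto simp: s_def f_inv_into_f inv_into_into)
  have uN: "univ N = s ` h ` W" by (simp add: N_def)
  have NW: "t \<in> W" "s (h t) = t" if "t \<in> univ N" for t
    using that hs by (auto simp: uN)
  have op: "opn M f (map h ts) \<in> h ` W" if "(f, length ts) \<in> S" "set ts \<subseteq> univ N" for f ts
  proof -
    have "App f ts \<in> W"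
      unfolding W_def using that NW(1) by (intro wf_terms.App) (auto simp: W_def)
    moreover have "h (App f ts) = opn M f (map h ts)" by (simp add: h_def)
    ultimately show ?thesis by (metis imageI)
  qed
  have "Var undefined \<in> W" by (simp add: W_def wf_terms.Var)
  then have algN: "is_algebra S N"
    using op by (auto simp: is_algebra_def uN N_def)
  have hN: "h ` univ N \<subseteq> univ M"
    using NW(1) eval_closed[OF algM _ g] by (auto simp: h_def W_def)
  have hom: "is_hom S N M h"
    using hN op hs(1) by (auto simp: is_hom_def N_def)
  have "eval N k l = eval N k r" if "(l, r) \<in> E" "range k \<subseteq> univ N" for l r k
  proof -
    have lr: "l \<in> wf_terms S" "r \<in> wf_terms S" using that(1) E by (auto simp: is_identities_def)
    have "range (h \<circ> k) \<subseteq> univ M" using that(2) hN by auto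
    then have "eval M (h \<circ> k) l = eval M (h \<circ> k) r"
      using M that(1) by (auto simp: members_def)
    then have "h (eval N k l) = h (eval N k r)"
      using hom_eval[OF algN hom _ that(2)] lr by simp
    moreover have "eval N k l \<in> univ N" "eval N k r \<in> univ N"
      using eval_closed[OF algN _ that(2)] lr by auto
    ultimately show ?thesis using NW(2) by metis
  qed
  then have N: "N \<in> members S E" using algN by (auto simp: members_def)
  have "g n \<in> h ` univ N" for n
  proof -
    have "g n = h (Var n)" by (simp add: h_def)
    moreover have "Var n \<in> W" by (simp add: W_def wf_terms.Var)
    ultimately have *: "g n \<in> h ` W" by blast
    then have "s (g n) \<in> univ N" by (auto simp: uN)
    then show ?thesis using hs(1)[OF *] by force
  qed
  then show thesis using that N hom by blast
qed

theorem congruence_modular_modular_Con: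
  fixes M :: "('f, 'a) algebra"
  assumes cm: "congruence_modular S E" and E: "is_identities S E" and M: "M \<in> members S E"
  shows "modular_Con S M"
  unfolding modular_Con_def
proof (intro ballI impI)
  fix \<alpha> \<beta> \<gamma> assume \<alpha>: "\<alpha> \<in> Con S M" and \<beta>: "\<beta> \<in> Con S M" and \<gamma>: "\<gamma> \<in> Con S M" and "\<alpha> \<subseteq> \<gamma>"
  have algM: "is_algebra S M" using M by (simp add: members_def)
  have sub: "\<alpha> \<union> \<beta> \<subseteq> Nabla M" "\<alpha> \<union> (\<beta> \<inter> \<gamma>) \<subseteq> Nabla M"
    using Con_subset[OF \<alpha>] Con_subset[OF \<beta>] by (auto simp: Nabla_def)
  note C = Cg_in_Con[OF algM sub(1)] Cg_in_Con[OF algM sub(2)]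
  show "Cg S M (\<alpha> \<union> (\<beta> \<inter> \<gamma>)) = Cg S M (\<alpha> \<union> \<beta>) \<inter> \<gamma>"
  proof
    have "Cg S M (\<alpha> \<union> (\<beta> \<inter> \<gamma>)) \<subseteq> Cg S M (\<alpha> \<union> \<beta>)"
      using Cg_extensive[of "\<alpha> \<union> \<beta>" S M] by (intro Cg_least[OF C(1)]) auto
    moreover have "Cg S M (\<alpha> \<union> (\<beta> \<inter> \<gamma>)) \<subseteq> \<gamma>"
      using \<open>\<alpha> \<subseteq> \<gamma>\<close> by (intro Cg_least[OF \<gamma>]) auto
    ultimately show "Cg S M (\<alpha> \<union> (\<beta> \<inter> \<gamma>)) \<subseteq> Cg S M (\<alpha> \<union> \<beta>) \<inter> \<gamma>" by blast
  next
    show "Cg S M (\<alpha> \<union> \<beta>) \<inter> \<gamma> \<subseteq> Cg S M (\<alpha> \<union> (\<beta> \<inter> \<gamma>))"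
    proof clarify
      fix x y assume xy: "(x, y) \<in> Cg S M (\<alpha> \<union> \<beta>)" "(x, y) \<in> \<gamma>"
      have "(x, y) \<in> (\<alpha> \<union> \<beta>)\<^sup>+" using xy(1) Con_join_trancl[OF algM \<alpha> \<beta>] by simp
      then have "\<exists>X. finite X \<and> X \<subseteq> univ M \<and> x \<in> X \<and> (x, y) \<in> ((\<alpha> \<union> \<beta>) \<inter> X \<times> X)\<^sup>+"
      proof (induction rule: trancl_induct)
        case (base y)
        then show ?case using sub(1)
          by (intro exI[of _ "{x, y}"]) (auto simp: Nabla_def)
      next
        case (step y z)
        then obtain X where X: "finite X" "X \<subseteq> univ M" "x \<in> X"
          "(x, y) \<in> ((\<alpha> \<union> \<beta>) \<inter> X \<times> X)\<^sup>+" by blast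
        let ?X = "insert y (insert z X)"
        have "(x, y) \<in> ((\<alpha> \<union> \<beta>) \<inter> ?X \<times> ?X)\<^sup>+"
          using X(4) by (rule rev_subsetD[OF _ trancl_mono_subset]) auto
        moreover have "(y, z) \<in> (\<alpha> \<union> \<beta>) \<inter> ?X \<times> ?X" using step(2) by blast
        ultimately have "(x, z) \<in> ((\<alpha> \<union> \<beta>) \<inter> ?X \<times> ?X)\<^sup>+"
          by (rule trancl.trancl_into_trancl)
        moreover have "?X \<subseteq> univ M" using X(2) step(2) sub(1) by (auto simp: Nabla_def)
        ultimately show ?case using X(1,3) by (intro exI[of _ ?X]) simp
      qed
      then obtain X where X: "finite X" "X \<subseteq> univ M" "x \<in> X"
        and ch: "(x, y) \<in> ((\<alpha> \<union> \<beta>) \<inter> X \<times> X)\<^sup>+" by blast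
      obtain l where l: "set l = X" using finite_list[OF X(1)] by blast
      define g where "g = (\<lambda>n. if n < length l then l ! n else x)"
      have rg: "range g = X" using l X(3) by (force simp: g_def in_set_conv_nth)
      obtain N :: "('f, ('f, nat) trm) algebra" and h
        where N: "N \<in> members S E" and hom: "is_hom S N M h" and gN: "range g \<subseteq> h ` univ N"
        using countably_generated_subalgebra[OF M E, of g] rg X(2) by auto
      have algN: "is_algebra S N" using N by (simp add: members_def)
      let ?p = "pullback N h"
      note p = pullback_in_Con[OF algN hom]
      have mono: "?p \<theta> \<subseteq> ?p \<theta>'" if "\<theta> \<subseteq> \<theta>'" for \<theta> \<theta>' using that by (auto simp: pullback_def)
      have pint: "?p (\<beta> \<inter> \<gamma>) = ?p \<beta> \<inter> ?p \<gamma>" by (auto simp: pullback_def)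
      have CN: "Cg S N (?p \<alpha> \<union> ?p \<beta>) \<in> Con S N"
        by (rule Cg_in_Con[OF algN]) (auto simp: pullback_def Nabla_def)
      define s where "s = inv_into (univ N) h"
      have s: "s u \<in> univ N" "h (s u) = u" if "u \<in> X" for u
        using that gN rg by (auto simp: s_def f_inv_into_f inv_into_into subset_iff)
      have link: "(s u, s v) \<in> Cg S N (?p \<alpha> \<union> ?p \<beta>)" if "(u, v) \<in> (\<alpha> \<union> \<beta>) \<inter> X \<times> X" for u v
        using that s Cg_extensive[of "?p \<alpha> \<union> ?p \<beta>" S N] by (auto simp: pullback_def)
      have "(s x, s y) \<in> Cg S N (?p \<alpha> \<union> ?p \<beta>)"
        using ch
      proof (induction rule: trancl_induct)
        case (base y) then show ?case by (rule link)
      next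
        case (step y z)
        then show ?case using link Con_trans[OF CN] by blast
      qed
      moreover have "y \<in> X" using ch by (auto elim: tranclE)
      then have "(s x, s y) \<in> ?p \<gamma>" using s X(3) xy(2) by (auto simp: pullback_def)
      moreover have "Cg S N (?p \<alpha> \<union> (?p \<beta> \<inter> ?p \<gamma>)) = Cg S N (?p \<alpha> \<union> ?p \<beta>) \<inter> ?p \<gamma>"
        using cm N p[OF \<alpha>] p[OF \<beta>] p[OF \<gamma>] mono[OF \<open>\<alpha> \<subseteq> \<gamma>\<close>]
        by (auto simp: congruence_modular_def modular_Con_def)
      ultimately have "(s x, s y) \<in> Cg S N (?p \<alpha> \<union> (?p \<beta> \<inter> ?p \<gamma>))" by blast
      also have "\<dots> \<subseteq> ?p (Cg S M (\<alpha> \<union> (\<beta> \<inter> \<gamma>)))"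
        using Cg_extensive[of "\<alpha> \<union> (\<beta> \<inter> \<gamma>)" S M]
        by (intro Cg_least p C) (auto simp: pullback_def)
      finally show "(x, y) \<in> Cg S M (\<alpha> \<union> (\<beta> \<inter> \<gamma>))"
        using s \<open>y \<in> X\<close> X(3) by (auto simp: pullback_def)
    qed
  qed
qed

end

theory Submission
  imports Defs
begin

text \<open>
  Let \<open>\<phi>\<close> be a prime congruence of \<open>A\<close> above the kernel of \<open>f\<close>. By Zorn's lemma there is a
  congruence \<open>\<psi>\<close> of \<open>B\<close> that is maximal subject to \<open>pullback A f \<psi> \<subseteq> \<phi>\<close>. If
  \<open>[\<alpha>, \<beta>] \<subseteq> \<psi>\<close>, then, with joins of congruences, \<open>[\<alpha> \<or> \<psi>, \<beta> \<or> \<psi>] \<subseteq> \<psi>\<close> by modularity; as term conditions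
  pull back along \<open>f\<close> and \<open>\<phi>\<close> is prime, one of the joins pulls back into \<open>\<phi>\<close>, so it equals \<open>\<psi>\<close>.
  Hence \<open>\<psi>\<close> is prime, and Going Up leads from \<open>pullback A f \<psi>\<close> to \<open>\<phi>\<close>.

  For the converse, take a five-element chain with the median and one unary operation. A majority
  operation makes congruence lattices distributive and the commutator equal to the intersection.
\<close>

section \<open>Substitution into terms, and encodings of tuples as sequences\<close>

section \<open>Terms\<close>

fun tsubst :: "('v \<Rightarrow> ('f, 'w) trm) \<Rightarrow> ('f, 'v) trm \<Rightarrow> ('f, 'w) trm" where
  "tsubst \<sigma> (Var v) = \<sigma> v"
| "tsubst \<sigma> (App s ts) = App s (map (tsubst \<sigma>) ts)"

lemma tsubst_wf:
  assumes "t \<in> wf_terms S" "\<And>v. \<sigma> v \<in> wf_terms S" shows "tsubst \<sigma> t \<in> wf_terms S"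
  using assms(1) by (induction rule: wf_terms.induct) (auto simp: assms(2) intro!: wf_terms.App)

lemma eval_tsubst: "eval M g (tsubst \<sigma> t) = eval M (\<lambda>v. eval M g (\<sigma> v)) t"
  by (induction t) (auto intro!: arg_cong[where f = "opn M _"])

lemma finite_vars: "finite (set2_trm t)"
  by (induction t) auto

lemma eval_cong_vars: "(\<And>v. v \<in> set2_trm t \<Longrightarrow> g v = h v) \<Longrightarrow> eval M g t = eval M h t"
proof (induction t)
  case (App s ts)
  have "eval M g t = eval M h t" if "t \<in> set ts" for t
    using App.IH[OF that] App.prems that by auto
  then show ?case by (simp cong: map_cong)
qed simp

lemma eval_Con:
  assumes "\<theta> \<in> Con S M" "t \<in> wf_terms S" "\<And>v. (g v, h v) \<in> \<theta>"
  shows "(eval M g t, eval M h t) \<in> \<theta>"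
  using assms(2)
proof (induction rule: wf_terms.induct)
  case (App s ts)
  then show ?case
    by (auto simp: list.rel_map intro!: Con_opn[OF assms(1)] list.rel_refl_strong)
qed (simp add: assms(3))

text \<open>Every variable of index 3 or more receives \<open>w\<close>, so any term over
  \<open>nat\<close> acts as a quaternary operation, whatever its variables.\<close>

definition quad :: "'x \<Rightarrow> 'x \<Rightarrow> 'x \<Rightarrow> 'x \<Rightarrow> nat \<Rightarrow> 'x" where
  "quad x y z w n = (if n = 0 then x else if n = 1 then y else if n = 2 then z else w)"

lemma eval_quad:
  "(\<lambda>n. eval M g (quad p q r s n)) = quad (eval M g p) (eval M g q) (eval M g r) (eval M g s)"
  by (auto simp: quad_def)

lemma range_quad: "range (quad x y z w) \<subseteq> U \<longleftrightarrow> x \<in> U \<and> y \<in> U \<and> z \<in> U \<and> w \<in> U"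
proof
  assume *: "range (quad x y z w) \<subseteq> U"
  have "quad x y z w n \<in> U" for n using * by auto
  from this[of 0] this[of 1] this[of 2] this[of 3]
  show "x \<in> U \<and> y \<in> U \<and> z \<in> U \<and> w \<in> U" by (simp add: quad_def)
qed (auto simp: quad_def)

text \<open>The term condition has one block of variables on each side; packing two tuples into one
  sequence lets \<open>term_condition_swap\<close> place two tuples in each block.\<close>

definition interleave :: "(nat \<Rightarrow> 'x) \<Rightarrow> (nat \<Rightarrow> 'x) \<Rightarrow> nat \<Rightarrow> 'x" where
  "interleave x y n = (if even n then x (n div 2) else y (n div 2))"

lemma interleave_simps [simp]:
  "interleave x y (2 * n) = x n" "interleave x y (Suc (2 * n)) = y n"
  by (auto simp: interleave_def)

section \<open>The clone as a free algebra of countable rank\<close>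

section \<open>The clone of term operations\<close>

text \<open>Term operations are made \<open>undefined\<close> outside the valuations in the universe, so that
  terms that agree on the universe give equal elements.\<close>

definition term_fun :: "('f, 'a) algebra \<Rightarrow> ('f, nat) trm \<Rightarrow> (nat \<Rightarrow> 'a) \<Rightarrow> 'a" where
  "term_fun M t v = (if range v \<subseteq> univ M then eval M v t else undefined)"

text \<open>Up to the convention on \<open>undefined\<close>, this is the free algebra with
  countably many generators in the variety generated by \<open>M\<close>.\<close>

definition clone :: "'f signature \<Rightarrow> ('f, 'a) algebra \<Rightarrow> ('f, (nat \<Rightarrow> 'a) \<Rightarrow> 'a) algebra" where
  "clone S M = \<lparr>univ = term_fun M ` wf_terms S,
     opn = (\<lambda>s ps v. if range v \<subseteq> univ M then opn M s (map (\<lambda>p. p v) ps) else undefined)\<rparr>"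

lemma univ_clone: "univ (clone S M) = term_fun M ` wf_terms S"
  by (simp add: clone_def)

lemma is_algebra_clone: "is_algebra S (clone S M)"
proof -
  have "opn (clone S M) s xs \<in> univ (clone S M)"
    if s: "(s, length xs) \<in> S" and xs: "set xs \<subseteq> univ (clone S M)" for s xs
  proof -
    have "xs \<in> map (term_fun M) ` lists (wf_terms S)"
      using xs by (simp add: univ_clone subset_iff in_lists_conv_set flip: lists_image)
    then obtain ts where ts: "set ts \<subseteq> wf_terms S" "xs = map (term_fun M) ts" by auto
    have "App s ts \<in> wf_terms S" using s ts by (auto intro!: wf_terms.App)
    moreover have "opn (clone S M) s xs = term_fun M (App s ts)"
      by (auto simp: clone_def ts(2) term_fun_def fun_eq_iff comp_def cong: map_cong)
    ultimately show ?thesis by (simp add: clone_def)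
  qed
  moreover have "term_fun M (Var 0) \<in> univ (clone S M)"
    by (auto simp: clone_def intro: wf_terms.Var)
  ultimately show ?thesis by (auto simp: is_algebra_def)
qed

text \<open>Evaluation at a valuation in the universe is a homomorphism to \<open>M\<close>, so
  identities transfer pointwise; at any other valuation all elements of the clone are
  \<open>undefined\<close>.\<close>

lemma clone_members:
  fixes M :: "('f, 'a) algebra"
  assumes M: "M \<in> members S E" and E: "is_identities S E"
  shows "clone S M \<in> members S E"
proof -
  have algM: "is_algebra S M" using M by (simp add: members_def)
  have "eval (clone S M) g l = eval (clone S M) g r"
    if lr: "(l, r) \<in> E" and g: "range g \<subseteq> univ (clone S M)" for l r g
  proof
    fix v :: "nat \<Rightarrow> 'a"
    have wf: "l \<in> wf_terms S" "r \<in> wf_terms S" using lr E by (auto simp: is_identities_def)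
    show "eval (clone S M) g l v = eval (clone S M) g r v"
    proof (cases "range v \<subseteq> univ M")
      case True
      then have hom: "is_hom S (clone S M) M (\<lambda>p. p v)"
        using eval_closed[OF algM _ True] by (auto simp: is_hom_def clone_def term_fun_def)
      have "range ((\<lambda>p. p v) \<circ> g) \<subseteq> univ M" using g hom by (auto simp: is_hom_def)
      then have "eval M ((\<lambda>p. p v) \<circ> g) l = eval M ((\<lambda>p. p v) \<circ> g) r"
        using M lr by (auto simp: members_def)
      then show ?thesis
        using hom_eval[OF is_algebra_clone hom _ g] wf by simp
    next
      case False
      then have "term_fun M t v = undefined" for t by (simp only: term_fun_def if_False)
      then have "p v = undefined" if "p \<in> univ (clone S M)" for p
        using that by (auto simp: univ_clone)
      then show ?thesis
        using eval_closed[OF is_algebra_clone _ g] wf by metis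
    qed
  qed
  then show ?thesis using is_algebra_clone by (auto simp: members_def)
qed

text \<open>The joint kernel of the evaluations at \<open>V\<close>. If \<open>V\<close> is given by
  equations between variables, it is the kernel of identifying those variables.\<close>

definition agree :: "'f signature \<Rightarrow> ('f, 'a) algebra \<Rightarrow> (nat \<Rightarrow> 'a) set \<Rightarrow> ((nat \<Rightarrow> 'a) \<Rightarrow> 'a) rel" where
  "agree S M V = {(p, q) \<in> univ (clone S M) \<times> univ (clone S M). \<forall>v \<in> V. p v = q v}"

lemma agree_in_Con: "agree S M V \<in> Con S (clone S M)"
proof (rule Con_I)
  fix s xs ys
  assume s: "(s, length xs) \<in> S" and xy: "list_all2 (\<lambda>x y. (x, y) \<in> agree S M V) xs ys"
  have "set xs \<subseteq> univ (clone S M)" "set ys \<subseteq> univ (clone S M)"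
    using list_all2_in_sets[OF xy, of "univ (clone S M)"] by (auto simp: agree_def)
  then have "opn (clone S M) s xs \<in> univ (clone S M)" "opn (clone S M) s ys \<in> univ (clone S M)"
    using s list_all2_lengthD[OF xy] by (auto intro!: is_algebra_opn[OF is_algebra_clone])
  moreover have "map (\<lambda>p. p v) xs = map (\<lambda>p. p v) ys" if "v \<in> V" for v
    using xy that by (induction rule: list_all2_induct) (auto simp: agree_def)
  ultimately show "(opn (clone S M) s xs, opn (clone S M) s ys) \<in> agree S M V"
    by (auto simp: agree_def clone_def)
qed (auto simp: agree_def)

section \<open>Day's terms, symmetry of the commutator, and joins\<close>

section \<open>Commutators in congruence-modular varieties\<close>

text \<open>
  Modularity of the congruence lattice of the clone, applied to the kernels of \<open>y = z\<close>, of
  \<open>x = y, z = w\<close> and of \<open>x = w, y = z\<close>, yields a chain of term operations from \<open>x\<close> to \<open>w\<close>: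
  these are Day's terms.
\<close>

lemma Day_principle:
  assumes cm: "congruence_modular S E" and E: "is_identities S E" and M: "M \<in> members S E"
    and \<delta>: "\<delta> \<in> Con S M" and ac: "a \<in> univ M" "c \<in> univ M" and bd: "(b, d) \<in> \<delta>"
    and H: "\<And>t. t \<in> wf_terms S \<Longrightarrow>
        (\<And>x y. x \<in> univ M \<Longrightarrow> y \<in> univ M \<Longrightarrow> eval M (quad x y y x) t = x) \<Longrightarrow>
        (eval M (quad a a c c) t, eval M (quad a b d c) t) \<in> \<delta>"
  shows "(a, c) \<in> \<delta>"
proof -
  let ?U = "univ M" and ?N = "clone S M"
  have bdU: "b \<in> ?U" "d \<in> ?U" using bd Con_subset[OF \<delta>] by auto
  define V\<alpha> where "V\<alpha> = {quad x y y w |x y w. x \<in> ?U \<and> y \<in> ?U \<and> w \<in> ?U}"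
  define V\<beta> where "V\<beta> = {quad x x w w |x w. x \<in> ?U \<and> w \<in> ?U}"
  define V\<gamma> where "V\<gamma> = {quad x y y x |x y. x \<in> ?U \<and> y \<in> ?U}"
  define \<alpha> \<beta> \<gamma> where "\<alpha> = agree S M V\<alpha>" and "\<beta> = agree S M V\<beta>" and "\<gamma> = agree S M V\<gamma>"
  have C: "\<alpha> \<in> Con S ?N" "\<beta> \<in> Con S ?N" "\<gamma> \<in> Con S ?N"
    by (simp_all add: \<alpha>_def \<beta>_def \<gamma>_def agree_in_Con)
  have "\<alpha> \<inter> \<gamma> \<in> Con S ?N" "\<beta> \<inter> \<gamma> \<in> Con S ?N"
    using Inter_in_Con[of "{\<alpha>, \<gamma>}" S ?N] Inter_in_Con[of "{\<beta>, \<gamma>}" S ?N] C by auto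
  note C = C this
  \<comment> \<open>\<open>V\<gamma>\<close> is part of \<open>V\<alpha>\<close>, and fewer
    valuations give a larger congruence. The modular law requires this inclusion.\<close>
  have "\<alpha> \<subseteq> \<gamma>" by (auto simp: \<alpha>_def \<gamma>_def agree_def V\<alpha>_def V\<gamma>_def)
  define X where "X n = term_fun M (Var n)" for n
  have X: "X n \<in> univ ?N" for n by (auto simp: X_def clone_def intro: wf_terms.Var)
  have Xv: "X n v = v n" if "range v \<subseteq> ?U" for v n using that by (simp add: X_def term_fun_def)
  \<comment> \<open>The first four variables form a path with edges in \<beta>, \<alpha>, \<beta>,
    whose ends are related by \<gamma>. Modularity replaces it by a path in \<alpha> \<union>
    (\<beta> \<inter> \<gamma>).\<close>
  have "(X 0, X 1) \<in> \<beta>" "(X 1, X 2) \<in> \<alpha>" "(X 2, X 3) \<in> \<beta>"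
    using X by (auto simp: \<alpha>_def \<beta>_def agree_def V\<alpha>_def V\<beta>_def Xv range_quad) (auto simp: quad_def)
  then have "(X 0, X 3) \<in> (\<alpha> \<union> \<beta>)\<^sup>+" by (meson Un_iff trancl.simps)
  moreover have "(X 0, X 3) \<in> \<gamma>"
    using X by (auto simp: \<gamma>_def agree_def V\<gamma>_def Xv range_quad) (auto simp: quad_def)
  moreover have "Cg S ?N (\<alpha> \<union> (\<beta> \<inter> \<gamma>)) = Cg S ?N (\<alpha> \<union> \<beta>) \<inter> \<gamma>"
    using congruence_modular_modular_Con[OF cm E clone_members[OF M E]] C \<open>\<alpha> \<subseteq> \<gamma>\<close>
    by (auto simp: modular_Con_def)
  ultimately have ch: "(X 0, X 3) \<in> (\<alpha> \<union> (\<beta> \<inter> \<gamma>))\<^sup>+"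
    using Con_join_trancl[OF is_algebra_clone C(1,2)] Con_join_trancl[OF is_algebra_clone C(1,5)]
    by simp
  have abdc: "range (quad a b d c) \<subseteq> ?U" "range (quad a b b c) \<subseteq> ?U" "range (quad a a c c) \<subseteq> ?U"
    using ac bdU by (auto simp: range_quad)
  \<comment> \<open>Exchanging \<open>d\<close> for \<open>b\<close> moves values only within
    \<delta> and produces the equal middle entries on which \<alpha> acts.\<close>
  have bb: "(p (quad a b d c), p (quad a b b c)) \<in> \<delta>" if p: "p \<in> univ ?N" for p
  proof -
    obtain t where "t \<in> wf_terms S" "p = term_fun M t" using p unfolding univ_clone by blast
    moreover have "(quad a b d c n, quad a b b c n) \<in> \<delta>" for n
      using ac bdU bd Con_refl[OF \<delta>] Con_sym[OF \<delta>] by (auto simp: quad_def)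
    ultimately show ?thesis using abdc by (auto simp: term_fun_def intro: eval_Con[OF \<delta>])
  qed
  \<comment> \<open>Being \<gamma>-related to the first variable means satisfying p(x, y, y, x) = x,
    which is what \<open>H\<close> asks of a term.\<close>
  have mid: "(p (quad a a c c), p (quad a b d c)) \<in> \<delta>" if "(X 0, p) \<in> \<gamma>" for p
  proof -
    have "p \<in> univ ?N" using that by (auto simp: \<gamma>_def agree_def)
    then obtain t where t: "t \<in> wf_terms S" "p = term_fun M t" unfolding univ_clone by blast
    have "eval M (quad x y y x) t = x" if "x \<in> ?U" "y \<in> ?U" for x y
    proof -
      have "X 0 (quad x y y x) = p (quad x y y x)"
        using \<open>(X 0, p) \<in> \<gamma>\<close> that by (auto simp: \<gamma>_def agree_def V\<gamma>_def)
      then show ?thesis using that by (simp add: Xv t(2) term_fun_def range_quad) (simp add: quad_def)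
    qed
    then show ?thesis using H[OF t(1)] t(2) abdc by (simp add: term_fun_def)
  qed
  note tr = Con_trans[OF \<delta>] and sy = Con_sym[OF \<delta>]
  \<comment> \<open>Across an \<alpha>-edge the operations agree at \<open>quad a b b c\<close>, and
    \<open>bb\<close> and \<open>mid\<close> carry this to \<open>quad a a c c\<close> modulo
    \<delta>; across an edge in \<beta> \<inter> \<gamma> they agree at \<open>quad a a c c\<close>
    outright.\<close>
  have link: "(q (quad a a c c), p (quad a a c c)) \<in> \<delta> \<and> (X 0, p) \<in> \<gamma>"
    if "(X 0, q) \<in> \<gamma>" "(q, p) \<in> \<alpha> \<union> (\<beta> \<inter> \<gamma>)" for p q
  proof -
    have g: "(X 0, p) \<in> \<gamma>" using that \<open>\<alpha> \<subseteq> \<gamma>\<close> Con_trans[OF C(3)] by blast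
    have N: "p \<in> univ ?N" "q \<in> univ ?N" using g that(1) by (auto simp: \<gamma>_def agree_def)
    show ?thesis
    proof (cases "(q, p) \<in> \<alpha>")
      case True
      then have "q (quad a b b c) = p (quad a b b c)"
        using ac bdU by (auto simp: \<alpha>_def agree_def V\<alpha>_def)
      then have "(q (quad a b d c), p (quad a b d c)) \<in> \<delta>"
        using bb N tr sy by metis
      then show ?thesis using mid[OF g] mid[OF that(1)] g tr sy by meson
    next
      case False
      then have "q (quad a a c c) = p (quad a a c c)"
        using that(2) ac by (auto simp: \<beta>_def agree_def V\<beta>_def)
      moreover have "p (quad a a c c) \<in> ?U"
        using mid[OF g] Con_subset[OF \<delta>] by auto
      ultimately show ?thesis using g Con_refl[OF \<delta>] by simp
    qed
  qed
  have "(X 0, X 0) \<in> \<gamma>" using Con_refl[OF C(3) X] .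
  have "(X 0 (quad a a c c), X 3 (quad a a c c)) \<in> \<delta> \<and> (X 0, X 3) \<in> \<gamma>"
    using ch
  proof (induction rule: trancl_induct)
    case (base y) then show ?case using link[OF \<open>(X 0, X 0) \<in> \<gamma>\<close>] by blast
  next
    case (step y z) then show ?case using link[of y z] tr by blast
  qed
  then show ?thesis by (simp add: Xv abdc) (simp add: quad_def)
qed

text \<open>This contains both the symmetry of the commutator (\<open>\<delta> = \<delta>'\<close>) and, applied twice, the fact
  that the term condition is inherited by larger congruences.\<close>

lemma term_condition_swap:
  fixes M :: "('f, 'a) algebra"
  assumes cm: "congruence_modular S E" and E: "is_identities S E" and M: "M \<in> members S E"
    and \<alpha>: "\<alpha> \<in> Con S M" and \<beta>: "\<beta> \<in> Con S M" and \<delta>: "\<delta> \<in> Con S M" and \<delta>': "\<delta>' \<in> Con S M"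
    and TC: "term_condition S M \<alpha> \<beta> \<delta>" and sub: "\<delta> \<subseteq> \<delta>'"
  shows "term_condition S M \<beta> \<alpha> \<delta>'"
  unfolding term_condition_def
proof (intro ballI allI impI)
  fix t :: "('f, nat + nat) trm" and a b c d :: "nat \<Rightarrow> 'a"
  assume t: "t \<in> wf_terms S" and abcd: "(\<forall>i. (a i, b i) \<in> \<beta>) \<and> (\<forall>j. (c j, d j) \<in> \<alpha>)"
    and ac_ad: "(eval M (case_sum a c) t, eval M (case_sum a d) t) \<in> \<delta>'"
  have algM: "is_algebra S M" using M by (simp add: members_def)
  have U: "a i \<in> univ M" "b i \<in> univ M" "c i \<in> univ M" "d i \<in> univ M" for i
    using abcd Con_subset[OF \<alpha>] Con_subset[OF \<beta>] by auto
  have tU: "eval M (case_sum x y) t \<in> univ M"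
    if "\<And>i. x i \<in> univ M" "\<And>i. y i \<in> univ M" for x y
    using that by (intro eval_closed[OF algM t]) (auto split: sum.splits)
  show "(eval M (case_sum b c) t, eval M (case_sum b d) t) \<in> \<delta>'"
  \<comment> \<open>The pair to be related is t(b, c), t(b, d); the pair known to be in \<delta>' is
    t(a, c), t(a, d).\<close>
  proof (rule Day_principle[OF cm E M \<delta>' _ _ ac_ad])
    fix p :: "('f, nat) trm"
    assume p: "p \<in> wf_terms S"
      and pid: "\<And>x y. x \<in> univ M \<Longrightarrow> y \<in> univ M \<Longrightarrow> eval M (quad x y y x) p = x"
    \<comment> \<open>\<open>r k l\<close> is \<open>t\<close> with its two blocks exchanged, as
      \<alpha> and \<beta> trade places; \<open>k\<close> and \<open>l\<close> will select the even
      or the odd half of an interleaved tuple.\<close>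
    define r :: "(nat \<Rightarrow> nat) \<Rightarrow> (nat \<Rightarrow> nat) \<Rightarrow> ('f, nat + nat) trm"
      where "r k l = tsubst (case_sum (\<lambda>i. Var (Inr (k i))) (\<lambda>j. Var (Inl (l j)))) t" for k l
    have r: "eval M (case_sum x y) (r k l) = eval M (case_sum (y \<circ> k) (x \<circ> l)) t" for k l x y
      unfolding r_def eval_tsubst
      by (rule arg_cong[where f = "\<lambda>g. eval M g t"]) (auto split: sum.splits)
    have rwf: "r k l \<in> wf_terms S" for k l
      unfolding r_def using t by (rule tsubst_wf) (auto split: sum.splits intro: wf_terms.Var)
    let ?e = "\<lambda>n::nat. 2 * n" and ?o = "\<lambda>n::nat. Suc (2 * n)"
    define s where "s = tsubst (quad (r ?e ?e) (r ?o ?e) (r ?o ?o) (r ?e ?o)) p"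
    have s: "eval M (case_sum (interleave x x') (interleave y y')) s =
        eval M (quad (eval M (case_sum y x) t) (eval M (case_sum y' x) t)
          (eval M (case_sum y' x') t) (eval M (case_sum y x') t)) p" for x x' y y'
      by (simp add: s_def eval_tsubst eval_quad r comp_def)
    have swf: "s \<in> wf_terms S"
      unfolding s_def using p by (rule tsubst_wf) (auto simp: quad_def rwf)
    \<comment> \<open>With u = t(b, c) and v = t(a, c), the two values are p(u, u, u, u) and p(u, v,
      v, u), both equal to u. Moving the second \<open>c\<close> to \<open>d\<close> is a change
      along \<alpha>, so \<open>TC\<close> then gives the relation that Day's principle
      needs.\<close>
    have "(eval M (case_sum (interleave c c) (interleave b b)) s,
        eval M (case_sum (interleave c c) (interleave b a)) s) \<in> \<delta>"
      using U tU Con_refl[OF \<delta>] by (simp add: s pid)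
    then have "(eval M (case_sum (interleave c d) (interleave b b)) s,
        eval M (case_sum (interleave c d) (interleave b a)) s) \<in> \<delta>"
      using TC[unfolded term_condition_def, rule_format, OF swf, of "interleave c c" "interleave c d"
          "interleave b b" "interleave b a"] abcd U Con_refl[OF \<alpha>] Con_refl[OF \<beta>] Con_sym[OF \<beta>]
      by (auto simp: interleave_def)
    then show "(eval M (quad (eval M (case_sum b c) t) (eval M (case_sum b c) t)
          (eval M (case_sum b d) t) (eval M (case_sum b d) t)) p,
        eval M (quad (eval M (case_sum b c) t) (eval M (case_sum a c) t)
          (eval M (case_sum a d) t) (eval M (case_sum b d) t)) p) \<in> \<delta>'"
      using sub by (auto simp: s)
  qed (use U tU in auto)
qed

text \<open>The join is a transitive closure, so entries can be moved one at a time by single steps: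
  \<alpha>-steps are covered by \<open>TC\<close>, and \<delta>-steps change both evaluations only
  modulo \<delta>.\<close>

lemma term_condition_join:
  fixes M :: "('f, 'a) algebra"
  assumes algM: "is_algebra S M" and \<alpha>: "\<alpha> \<in> Con S M" and \<beta>: "\<beta> \<in> Con S M" and \<delta>: "\<delta> \<in> Con S M"
    and TC: "term_condition S M \<alpha> \<beta> \<delta>"
  shows "term_condition S M (Cg S M (\<alpha> \<union> \<delta>)) \<beta> \<delta>"
  unfolding term_condition_def
proof (intro ballI allI impI)
  fix t :: "('f, nat + nat) trm" and a b c d :: "nat \<Rightarrow> 'a"
  assume t: "t \<in> wf_terms S"
    and "(\<forall>i. (a i, b i) \<in> Cg S M (\<alpha> \<union> \<delta>)) \<and> (\<forall>j. (c j, d j) \<in> \<beta>)"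
    and start: "(eval M (case_sum a c) t, eval M (case_sum a d) t) \<in> \<delta>"
  then have ab: "(a i, b i) \<in> (\<alpha> \<union> \<delta>)\<^sup>+" and cd: "(c i, d i) \<in> \<beta>" for i
    using Con_join_trancl[OF algM \<alpha> \<delta>] by auto
  have "(\<alpha> \<union> \<delta>)\<^sup>+ \<subseteq> univ M \<times> univ M"
    using Con_subset[OF \<alpha>] Con_subset[OF \<delta>] by (intro trancl_subset_Sigma) auto
  then have U: "a i \<in> univ M" "b i \<in> univ M" "c i \<in> univ M" "d i \<in> univ M" for i
    using ab[of i] cd[of i] Con_subset[OF \<beta>] by auto
  define P where "P x \<longleftrightarrow> (eval M (case_sum x c) t, eval M (case_sum x d) t) \<in> \<delta>" for x
  have unit: "P (x(k := v))" if P: "P (x(k := u))" and uv: "(u, v) \<in> \<alpha> \<union> \<delta>"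
    and x: "\<And>i. x i \<in> univ M" for x k u v
  proof (cases "(u, v) \<in> \<alpha>")
    case True
    then show ?thesis
      using TC[unfolded term_condition_def, rule_format, OF t, of "x(k := u)" "x(k := v)" c d]
        P cd x Con_refl[OF \<alpha>] by (auto simp: P_def)
  next
    case False
    then have uv: "(v, u) \<in> \<delta>" using uv Con_sym[OF \<delta>] by auto
    have "(eval M (case_sum (x(k := v)) y) t, eval M (case_sum (x(k := u)) y) t) \<in> \<delta>"
      if "\<And>i. y i \<in> univ M" for y
      using uv x that Con_refl[OF \<delta>] by (intro eval_Con[OF \<delta> t]) (auto split: sum.splits)
    from this[of c] this[of d] show ?thesis
      using P U Con_trans[OF \<delta>] Con_sym[OF \<delta>] unfolding P_def by meson
  qed
  have chain: "P (x(k := v))" if "(u, v) \<in> (\<alpha> \<union> \<delta>)\<^sup>+" "P (x(k := u))" "\<And>i. x i \<in> univ M" for x k u v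
    using that(1)
  proof (induction rule: trancl_induct)
    case (base y) then show ?case using unit that by blast
  next
    case (step y z) then show ?case using unit that by blast
  qed
  have P: "P (\<lambda>i. if i < n then b i else a i)" for n
  proof (induction n)
    case 0 then show ?case using start by (simp add: P_def)
  next
    case (Suc n)
    let ?x = "\<lambda>i. if i < n then b i else a i"
    have "?x(n := a n) = ?x" "?x(n := b n) = (\<lambda>i. if i < Suc n then b i else a i)"
      by (auto simp: fun_eq_iff less_Suc_eq)
    then show ?case using chain[OF ab, of ?x n n] Suc U by simp
  qed
  \<comment> \<open>A term has finitely many variables, so replacing the entries below some
    \<open>n\<close> already gives the value at \<open>b\<close>.\<close>
  have "finite {i. Inl i \<in> set2_trm t}"
    using finite_vimageI[OF finite_vars, of Inl t] by (simp add: vimage_def)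
  then obtain n where n: "\<And>i. Inl i \<in> set2_trm t \<Longrightarrow> i < n"
    by (metis finite_nat_set_iff_bounded mem_Collect_eq)
  have "eval M (case_sum (\<lambda>i. if i < n then b i else a i) y) t = eval M (case_sum b y) t" for y
    using n by (intro eval_cong_vars) (auto split: sum.splits)
  then show "(eval M (case_sum b c) t, eval M (case_sum b d) t) \<in> \<delta>"
    using P[of n] by (simp add: P_def)
qed

text \<open>Only the first argument can be enlarged directly, so the arguments are swapped before
  each enlargement. The first swap also passes from the commutator to the larger \<delta>.\<close>

lemma term_condition_joins:
  assumes cm: "congruence_modular S E" and E: "is_identities S E" and M: "M \<in> members S E"
    and \<alpha>: "\<alpha> \<in> Con S M" and \<beta>: "\<beta> \<in> Con S M" and \<delta>: "\<delta> \<in> Con S M"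
    and sub: "commutator S M \<alpha> \<beta> \<subseteq> \<delta>"
  shows "term_condition S M (Cg S M (\<alpha> \<union> \<delta>)) (Cg S M (\<beta> \<union> \<delta>)) \<delta>"
proof -
  note swap = term_condition_swap[OF cm E M]
  have algM: "is_algebra S M" using M by (simp add: members_def)
  have C: "Cg S M (\<alpha> \<union> \<delta>) \<in> Con S M" "Cg S M (\<beta> \<union> \<delta>) \<in> Con S M"
    using Con_subset[OF \<alpha>] Con_subset[OF \<beta>] Con_subset[OF \<delta>]
    by (auto intro!: Cg_in_Con[OF algM] simp: Nabla_def)
  have "term_condition S M \<beta> \<alpha> \<delta>"
    using swap[OF \<alpha> \<beta> commutator_in_Con[OF algM \<alpha> \<beta>] \<delta> commutator_term_condition sub] .
  then have "term_condition S M (Cg S M (\<beta> \<union> \<delta>)) \<alpha> \<delta>"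
    by (rule term_condition_join[OF algM \<beta> \<alpha> \<delta>])
  then have "term_condition S M \<alpha> (Cg S M (\<beta> \<union> \<delta>)) \<delta>"
    using swap[OF C(2) \<alpha> \<delta> \<delta>] by blast
  then show ?thesis by (rule term_condition_join[OF algM \<alpha> C(2) \<delta>])
qed

section \<open>Pullbacks of term conditions and a prime found by Zorn's lemma\<close>

section \<open>Going Up implies Lying Over\<close>

text \<open>Homomorphisms commute with term evaluation, so a failure in \<open>A\<close> would be
  mapped to a failure in \<open>B\<close>.\<close>

lemma term_condition_pullback:
  fixes f :: "'a \<Rightarrow> 'b" and A :: "('f, 'a) algebra"
  assumes A: "is_algebra S A" and f: "is_hom S A B f" and TC: "term_condition S B \<alpha> \<beta> \<delta>"
  shows "term_condition S A (pullback A f \<alpha>) (pullback A f \<beta>) (pullback A f \<delta>)"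
  unfolding term_condition_def
proof (intro ballI allI impI)
  fix t :: "('f, nat + nat) trm" and a b c d :: "nat \<Rightarrow> 'a"
  assume t: "t \<in> wf_terms S"
    and h: "(\<forall>i. (a i, b i) \<in> pullback A f \<alpha>) \<and> (\<forall>j. (c j, d j) \<in> pullback A f \<beta>)"
    and ac_ad: "(eval A (case_sum a c) t, eval A (case_sum a d) t) \<in> pullback A f \<delta>"
  have U: "a i \<in> univ A" "b i \<in> univ A" "c i \<in> univ A" "d i \<in> univ A" for i
    using h by (auto simp: pullback_def)
  have tr: "f (eval A (case_sum x y) t) = eval B (case_sum (f \<circ> x) (f \<circ> y)) t"
    "eval A (case_sum x y) t \<in> univ A"
    if "\<And>i. x i \<in> univ A" "\<And>i. y i \<in> univ A" for x y
  proof -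
    have r: "range (case_sum x y) \<subseteq> univ A" using that by (auto split: sum.splits)
    have "f \<circ> case_sum x y = case_sum (f \<circ> x) (f \<circ> y)" by (auto split: sum.splits)
    then show "f (eval A (case_sum x y) t) = eval B (case_sum (f \<circ> x) (f \<circ> y)) t"
      using hom_eval[OF A f t r] by simp
    show "eval A (case_sum x y) t \<in> univ A" by (rule eval_closed[OF A t r])
  qed
  show "(eval A (case_sum b c) t, eval A (case_sum b d) t) \<in> pullback A f \<delta>"
    using TC[unfolded term_condition_def, rule_format, OF t, of "f \<circ> a" "f \<circ> b" "f \<circ> c" "f \<circ> d"]
      h ac_ad U tr by (auto simp: pullback_def)
qed

lemma Delta_in_Con:
  assumes "is_algebra S M" shows "Delta M \<in> Con S M"
proof (rule Con_I)
  fix s xs ys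
  assume *: "(s, length xs) \<in> S" "list_all2 (\<lambda>x y. (x, y) \<in> Delta M) xs ys"
  have "set xs \<subseteq> univ M" using list_all2_in_sets[OF *(2)] by (auto simp: Delta_def)
  moreover have "xs = ys"
    using *(2) by (induction rule: list_all2_induct) (auto simp: Delta_def)
  ultimately show "(opn M s xs, opn M s ys) \<in> Delta M"
    using is_algebra_opn[OF assms *(1)] by (simp add: Delta_def Id_on_iff)
qed (auto simp: Delta_def)

text \<open>Operations are finitary, so all pairs of arguments lie in a single member of a nonempty
  chain. This supplies the upper bounds for Zorn's lemma.\<close>

lemma Union_chain_in_Con:
  assumes ch: "subset.chain (Con S M) C" and ne: "C \<noteq> {}"
  shows "\<Union>C \<in> Con S M"
proof (rule Con_I)
  have C: "\<theta> \<in> Con S M" if "\<theta> \<in> C" for \<theta> using that ch by (auto simp: subset.chain_def)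
  have lin: "\<theta> \<subseteq> \<theta>' \<or> \<theta>' \<subseteq> \<theta>" if "\<theta> \<in> C" "\<theta>' \<in> C" for \<theta> \<theta>'
    using that ch by (auto simp: subset.chain_def)
  show "\<Union>C \<subseteq> univ M \<times> univ M" using C Con_subset by fast
  show "(x, x) \<in> \<Union>C" if "x \<in> univ M" for x using that ne Con_refl[OF C] by blast
  show "(y, x) \<in> \<Union>C" if "(x, y) \<in> \<Union>C" for x y using that Con_sym[OF C] by blast
  show "(x, z) \<in> \<Union>C" if xy: "(x, y) \<in> \<Union>C" and yz: "(y, z) \<in> \<Union>C" for x y z
  proof -
    obtain \<theta> \<theta>' where "\<theta> \<in> C" "\<theta>' \<in> C" "(x, y) \<in> \<theta>" "(y, z) \<in> \<theta>'" using xy yz by blast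
    then show ?thesis using lin[of \<theta> \<theta>'] Con_trans[OF C] by blast
  qed
  show "(opn M s xs, opn M s ys) \<in> \<Union>C"
    if s: "(s, length xs) \<in> S" and "list_all2 (\<lambda>x y. (x, y) \<in> \<Union>C) xs ys" for s xs ys
  proof -
    have "\<exists>\<theta>\<in>C. list_all2 (\<lambda>x y. (x, y) \<in> \<theta>) xs ys"
      using that(2)
    proof (induction rule: list_all2_induct)
      case Nil then show ?case using ne by auto
    next
      case (Cons x xs y ys)
      then obtain \<theta> \<theta>' where *: "\<theta> \<in> C" "\<theta>' \<in> C" "(x, y) \<in> \<theta>" "list_all2 (\<lambda>x y. (x, y) \<in> \<theta>') xs ys"
        by blast
      define \<eta> where "\<eta> = \<theta> \<union> \<theta>'"
      have "\<eta> \<in> C" using lin[OF *(1,2)] *(1,2) by (auto simp: \<eta>_def sup_absorb1 sup_absorb2)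
      moreover have "list_all2 (\<lambda>x y. (x, y) \<in> \<eta>) xs ys"
        using *(4) by (rule list_all2_mono) (simp add: \<eta>_def)
      moreover have "(x, y) \<in> \<eta>" using *(3) by (simp add: \<eta>_def)
      ultimately show ?case by auto
    qed
    then show ?thesis using Con_opn[OF C s] by blast
  qed
qed

text \<open>A congruence of \<open>B\<close> that is maximal among those whose pullback lies in \<open>\<phi>\<close> is prime.\<close>

lemma prime_below:
  assumes cm: "congruence_modular S E" and E: "is_identities S E"
    and A: "A \<in> members S E" and B: "B \<in> members S E" and f: "is_hom S A B f"
    and \<phi>: "\<phi> \<in> Spec S A" and ker: "Ker A B f \<subseteq> \<phi>"
  obtains \<psi> where "\<psi> \<in> Spec S B" "pullback A f \<psi> \<subseteq> \<phi>"
proof -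
  have alg: "is_algebra S A" "is_algebra S B" using A B by (auto simp: members_def)
  note pb = pullback_in_Con[OF alg(1) f]
  have prime: "\<alpha> \<subseteq> \<phi> \<or> \<beta> \<subseteq> \<phi>"
    if "commutator S A \<alpha> \<beta> \<subseteq> \<phi>" "\<alpha> \<in> Con S A" "\<beta> \<in> Con S A" for \<alpha> \<beta>
    using \<phi> that by (auto simp: Spec_def prime_congruence_def)
  have \<phi>C: "\<phi> \<in> Con S A" "\<phi> \<noteq> Nabla A" using \<phi> by (auto simp: Spec_def prime_congruence_def)
  define F where "F = {\<psi> \<in> Con S B. pullback A f \<psi> \<subseteq> \<phi>}"
  \<comment> \<open>The kernel hypothesis enters here, to make \<open>F\<close> nonempty.\<close>
  have "Delta B \<in> F" using Delta_in_Con[OF alg(2)] ker by (simp add: F_def Ker_def)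
  moreover have "\<Union>C \<in> F" if "C \<noteq> {}" "subset.chain F C" for C
  proof -
    have "subset.chain (Con S B) C" using that(2) by (auto simp: F_def subset.chain_def)
    moreover have "pullback A f (\<Union>C) \<subseteq> \<phi>"
      using that(2) by (fastforce simp: F_def subset.chain_def pullback_def)
    ultimately show ?thesis using Union_chain_in_Con that(1) by (auto simp: F_def)
  qed
  ultimately obtain \<psi> where \<psi>F: "\<psi> \<in> F" and max: "\<And>\<theta>. \<theta> \<in> F \<Longrightarrow> \<psi> \<subseteq> \<theta> \<Longrightarrow> \<theta> = \<psi>"
    using subset_Zorn_nonempty[of F] by blast
  have \<psi>: "\<psi> \<in> Con S B" "pullback A f \<psi> \<subseteq> \<phi>" using \<psi>F by (auto simp: F_def)
  have "\<alpha> \<subseteq> \<psi> \<or> \<beta> \<subseteq> \<psi>"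
    if \<alpha>: "\<alpha> \<in> Con S B" and \<beta>: "\<beta> \<in> Con S B" and c: "commutator S B \<alpha> \<beta> \<subseteq> \<psi>" for \<alpha> \<beta>
  proof -
    let ?\<alpha> = "Cg S B (\<alpha> \<union> \<psi>)" and ?\<beta> = "Cg S B (\<beta> \<union> \<psi>)"
    have C: "?\<alpha> \<in> Con S B" "?\<beta> \<in> Con S B"
      using Con_subset[OF \<alpha>] Con_subset[OF \<beta>] Con_subset[OF \<psi>(1)]
      by (auto intro!: Cg_in_Con[OF alg(2)] simp: Nabla_def)
    have "commutator S A (pullback A f ?\<alpha>) (pullback A f ?\<beta>) \<subseteq> pullback A f \<psi>"
      using term_condition_joins[OF cm E B \<alpha> \<beta> \<psi>(1) c]
      by (intro commutator_least[OF pb[OF \<psi>(1)]] term_condition_pullback[OF alg(1) f])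
    then have "pullback A f ?\<alpha> \<subseteq> \<phi> \<or> pullback A f ?\<beta> \<subseteq> \<phi>"
      using \<psi>(2) prime pb C by blast
    then have "?\<alpha> \<in> F \<or> ?\<beta> \<in> F" using C by (auto simp: F_def)
    then show ?thesis
      using max Cg_extensive[of "\<alpha> \<union> \<psi>" S B] Cg_extensive[of "\<beta> \<union> \<psi>" S B] by blast
  qed
  \<comment> \<open>Properness is inherited from \<phi>: the pullback of \<open>Nabla B\<close> is
    all of \<open>Nabla A\<close>.\<close>
  moreover have "\<psi> \<noteq> Nabla B"
  proof
    assume "\<psi> = Nabla B"
    then have "pullback A f \<psi> = Nabla A" using f by (auto simp: pullback_def Nabla_def is_hom_def)
    then show False using \<psi>(2) \<phi>C Con_subset[OF \<phi>C(1)] by (auto simp: Nabla_def)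
  qed
  ultimately have "\<psi> \<in> Spec S B" using \<psi>(1) unfolding Spec_def prime_congruence_def by blast
  then show thesis using that \<psi>(2) by blast
qed

lemma GU_imp_LO:
  assumes cm: "congruence_modular S E" and E: "is_identities S E"
    and A: "A \<in> members S E" and B: "B \<in> members S E" and f: "admissible S A B f"
    and GU: "fulfills_GU S A B f"
  shows "fulfills_LO S A B f"
  unfolding fulfills_LO_def
proof (intro ballI impI)
  fix \<phi> assume \<phi>: "\<phi> \<in> Spec S A" "Ker A B f \<subseteq> \<phi>"
  obtain \<psi> where \<psi>: "\<psi> \<in> Spec S B" "pullback A f \<psi> \<subseteq> \<phi>"
    using prime_below[OF cm E A B _ \<phi>] f by (auto simp: admissible_def)
  \<comment> \<open>Admissibility makes the lower end of the inclusion prime, as Going Up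
    requires.\<close>
  then have "pullback A f \<psi> \<in> Spec S A" using f by (auto simp: admissible_def)
  then show "\<exists>\<phi>\<^sub>1\<in>Spec S B. pullback A f \<phi>\<^sub>1 = \<phi>"
    using GU \<psi> \<phi>(1) unfolding fulfills_GU_def by blast
qed

section \<open>Modularity and the commutator under a majority operation\<close>

section \<open>Majority operations\<close>

definition majority_identities :: "'f \<Rightarrow> 'f identities" where
  "majority_identities m = {(App m [Var 0, Var 0, Var 1], Var 0), (App m [Var 0, Var 1, Var 0], Var 0),
     (App m [Var 1, Var 0, Var 0], Var 0)}"

lemma is_identities_majority:
  assumes "(m, 3) \<in> S" shows "is_identities S (majority_identities m)"
proof -
  have "App m [Var i, Var j, Var k] \<in> wf_terms S" for i j k
    using assms by (intro wf_terms.App) (auto simp: numeral_3_eq_3 intro: wf_terms.Var)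
  then show ?thesis by (auto simp: is_identities_def majority_identities_def intro: wf_terms.Var)
qed

lemma majority_opn:
  fixes M :: "('f, 'a) algebra"
  assumes "M \<in> members S (majority_identities m)" "x \<in> univ M" "y \<in> univ M"
  shows "opn M m [x, x, y] = x" "opn M m [x, y, x] = x" "opn M m [y, x, x] = x"
proof -
  define g where "g = (\<lambda>n::nat. if n = 0 then x else y)"
  have "range g \<subseteq> univ M" using assms by (auto simp: g_def)
  then have "eval M g l = eval M g r" if "(l, r) \<in> majority_identities m" for l r
    using assms(1) that by (auto simp: members_def)
  from this[of "App m [Var 0, Var 0, Var 1]" "Var 0"] this[of "App m [Var 0, Var 1, Var 0]" "Var 0"]
    this[of "App m [Var 1, Var 0, Var 0]" "Var 0"]
  show "opn M m [x, x, y] = x" "opn M m [x, y, x] = x" "opn M m [y, x, x] = x"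
    by (simp_all add: majority_identities_def g_def)
qed

lemma majority_Con:
  assumes "\<theta> \<in> Con S M" "(m, 3) \<in> S" "(x, x') \<in> \<theta>" "(y, y') \<in> \<theta>" "(z, z') \<in> \<theta>"
  shows "(opn M m [x, y, z], opn M m [x', y', z']) \<in> \<theta>"
proof -
  have "(m, length [x, y, z]) \<in> S" using assms(2) by (simp add: eval_nat_numeral)
  from Con_opn[OF assms(1) this, of "[x', y', z']"] show ?thesis using assms by simp
qed

text \<open>The map z to m(x, z, y) turns an \<alpha> \<union> \<beta> path from x to y into another
  one. If (x, y) \<in> \<gamma>, all its points are \<gamma>-related to m(x, z, x) = x, so its
  \<beta>-edges lie in \<beta> \<inter> \<gamma>.\<close>

lemma majority_modular_Con:
  assumes M: "M \<in> members S (majority_identities m)" and m: "(m, 3) \<in> S"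
  shows "modular_Con S M"
  unfolding modular_Con_def
proof (intro ballI impI)
  fix \<alpha> \<beta> \<gamma> assume \<alpha>: "\<alpha> \<in> Con S M" and \<beta>: "\<beta> \<in> Con S M" and \<gamma>: "\<gamma> \<in> Con S M" and sub: "\<alpha> \<subseteq> \<gamma>"
  have algM: "is_algebra S M" using M by (simp add: members_def)
  have \<beta>\<gamma>: "\<beta> \<inter> \<gamma> \<in> Con S M" using Inter_in_Con[of "{\<beta>, \<gamma>}" S M] \<beta> \<gamma> by simp
  let ?J = "\<alpha> \<union> (\<beta> \<inter> \<gamma>)"
  have "(\<alpha> \<union> \<beta>)\<^sup>+ \<inter> \<gamma> \<subseteq> ?J\<^sup>+"
  proof clarify
    fix x y assume ch: "(x, y) \<in> (\<alpha> \<union> \<beta>)\<^sup>+" and xy: "(x, y) \<in> \<gamma>"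
    have U: "x \<in> univ M" "y \<in> univ M" using xy Con_subset[OF \<gamma>] by auto
    have \<gamma>x: "(opn M m [x, z, y], x) \<in> \<gamma>" if "z \<in> univ M" for z
      using majority_Con[OF \<gamma> m Con_refl[OF \<gamma>] Con_refl[OF \<gamma>] Con_sym[OF \<gamma> xy], of x z] that U
        majority_opn[OF M U(1) that] by simp
    have link: "(opn M m [x, z, y], opn M m [x, w, y]) \<in> ?J" if zw: "(z, w) \<in> \<alpha> \<union> \<beta>" for z w
    proof -
      have "z \<in> univ M" "w \<in> univ M" using zw Con_subset[OF \<alpha>] Con_subset[OF \<beta>] by auto
      then have "(opn M m [x, z, y], opn M m [x, w, y]) \<in> \<gamma>"
        using \<gamma>x Con_trans[OF \<gamma>] Con_sym[OF \<gamma>] by meson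
      moreover have "(opn M m [x, z, y], opn M m [x, w, y]) \<in> \<alpha> \<union> \<beta>"
        using zw majority_Con[OF \<alpha> m Con_refl[OF \<alpha> U(1)] _ Con_refl[OF \<alpha> U(2)], of z w]
          majority_Con[OF \<beta> m Con_refl[OF \<beta> U(1)] _ Con_refl[OF \<beta> U(2)], of z w] by blast
      ultimately show ?thesis by blast
    qed
    have "(opn M m [x, x, y], opn M m [x, z, y]) \<in> ?J\<^sup>+" if "(x, z) \<in> (\<alpha> \<union> \<beta>)\<^sup>+" for z
      using that
    proof (induction rule: trancl_induct)
      case (base z) then show ?case using link by blast
    next
      case (step z w)
      show ?case using step.IH link[OF step.hyps(2)] by (rule trancl.trancl_into_trancl)
    qed
    from this[OF ch] show "(x, y) \<in> ?J\<^sup>+" using majority_opn[OF M] U by simp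
  qed
  moreover have "?J \<subseteq> \<alpha> \<union> \<beta>" by blast
  then have "?J\<^sup>+ \<subseteq> (\<alpha> \<union> \<beta>)\<^sup>+" by (rule trancl_mono_subset)
  moreover have "Cg S M ?J \<subseteq> \<gamma>" using sub by (intro Cg_least[OF \<gamma>]) blast
  then have "?J\<^sup>+ \<subseteq> \<gamma>" by (simp only: Con_join_trancl[OF algM \<alpha> \<beta>\<gamma>])
  ultimately show "Cg S M ?J = Cg S M (\<alpha> \<union> \<beta>) \<inter> \<gamma>"
    unfolding Con_join_trancl[OF algM \<alpha> \<beta>] Con_join_trancl[OF algM \<alpha> \<beta>\<gamma>]
    by (intro equalityI Int_greatest)
qed

text \<open>The term condition is applied to m itself: m(x, x, x) = m(x, x, y), and changing the
  middle entry to y along \<alpha> turns this pair into m(x, y, x) = x and m(x, y, y) = y.\<close>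

lemma majority_commutator:
  assumes M: "M \<in> members S (majority_identities m)" and m: "(m, 3) \<in> S"
    and \<alpha>: "\<alpha> \<in> Con S M" and \<beta>: "\<beta> \<in> Con S M"
  shows "\<alpha> \<inter> \<beta> \<subseteq> commutator S M \<alpha> \<beta>"
proof clarify
  fix x y assume xy: "(x, y) \<in> \<alpha>" "(x, y) \<in> \<beta>"
  have U: "x \<in> univ M" "y \<in> univ M" using xy(1) Con_subset[OF \<alpha>] by auto
  have algM: "is_algebra S M" using M by (simp add: members_def)
  let ?t = "App m [Var (Inl 0), Var (Inl 1), Var (Inr 0)] :: (_, nat + nat) trm"
  have t: "?t \<in> wf_terms S"
    using m by (intro wf_terms.App) (auto simp: numeral_3_eq_3 intro: wf_terms.Var)
  have "(x, x) \<in> commutator S M \<alpha> \<beta>"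
    using Con_refl[OF commutator_in_Con[OF algM \<alpha> \<beta>]] U by blast
  then show "(x, y) \<in> commutator S M \<alpha> \<beta>"
    using commutator_term_condition[of S M \<alpha> \<beta>, unfolded term_condition_def, rule_format, OF t,
        of "\<lambda>_. x" "\<lambda>i. if i = 0 then x else y" "\<lambda>_. x" "\<lambda>_. y"] xy Con_refl[OF \<alpha>] U
    by (simp add: majority_opn[OF M])
qed

text \<open>Two congruences not below \<phi> both contain \<open>p\<close>, hence so does their
  commutator, which therefore is not below \<phi> either.\<close>

lemma Spec_majorityI:
  assumes M: "M \<in> members S (majority_identities m)" and m: "(m, 3) \<in> S"
    and \<phi>: "\<phi> \<in> Con S M" and p: "p \<in> Nabla M" "p \<notin> \<phi>"
    and least: "\<And>\<alpha>. \<alpha> \<in> Con S M \<Longrightarrow> \<not> \<alpha> \<subseteq> \<phi> \<Longrightarrow> p \<in> \<alpha>"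
  shows "\<phi> \<in> Spec S M"
proof -
  have "\<alpha> \<subseteq> \<phi> \<or> \<beta> \<subseteq> \<phi>"
    if "\<alpha> \<in> Con S M" "\<beta> \<in> Con S M" "commutator S M \<alpha> \<beta> \<subseteq> \<phi>" for \<alpha> \<beta>
    using majority_commutator[OF M m that(1,2)] that least p(2) by blast
  then show ?thesis using \<phi> p by (auto simp: Spec_def prime_congruence_def)
qed

section \<open>A five-element chain with median\<close>

section \<open>Lying Over does not imply Going Up\<close>

text \<open>
  The universe \<open>{..4}\<close> is the chain of pairs \<open>(0, 0) < (1, 0) < (2, 0) < (3, 0) < (3, 1)\<close>. The
  first projection (with kernel \<open>min 3\<close>) is onto a simple algebra, which has \<open>{0, 2, 4}\<close> as a
  subalgebra that is not simple; the second one (with kernel \<open>\<lambda>x. x div 4\<close>) restricts to the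
  proper quotient of this subalgebra.
\<close>

definition med :: "nat \<Rightarrow> nat \<Rightarrow> nat \<Rightarrow> nat" where
  "med x y z = max (min x y) (max (min y z) (min x z))"

text \<open>The values at 0, ..., 4 are 0, 3, 0, 2, 2. Only 1 is sent to 3: this spreads (0, 1) to
  (0, 3), whereas in {0, 2, 4} the pair (0, 2) can be collapsed alone.\<close>

definition shuffle :: "nat \<Rightarrow> nat" where
  "shuffle n = (if n = 1 then 3 else if n \<ge> 3 then 2 else 0)"

definition ex_sig :: "nat signature" where
  "ex_sig = {(0, 3), (1, 1)}"

definition ex_alg :: "nat set \<Rightarrow> (nat, nat) algebra" where
  "ex_alg U = \<lparr>univ = U,
     opn = (\<lambda>s xs. if s = 0 then med (xs ! 0) (xs ! 1) (xs ! 2) else shuffle (xs ! 0))\<rparr>"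

definition same :: "nat set \<Rightarrow> (nat \<Rightarrow> nat) \<Rightarrow> nat rel" where
  "same U k = {(x, y) \<in> U \<times> U. k x = k y}"

lemma univ_ex_alg [simp]: "univ (ex_alg U) = U"
  by (simp add: ex_alg_def)

lemma opn_ex_alg [simp]:
  "opn (ex_alg U) 0 [x, y, z] = med x y z" "opn (ex_alg U) (Suc 0) [x] = shuffle x"
  by (auto simp: ex_alg_def)

lemma sig_cases:
  assumes "(s, length xs) \<in> ex_sig"
  obtains x y z where "s = 0" "xs = [x, y, z]" | x where "s = 1" "xs = [x]"
  using assms by (auto simp: ex_sig_def numeral_3_eq_3 length_Suc_conv)

lemma ex_sig [simp]: "(0, 3) \<in> ex_sig" "(Suc 0, Suc 0) \<in> ex_sig"
  by (auto simp: ex_sig_def)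

text \<open>The median returns one of its arguments, so closure is a condition on
  \<open>shuffle\<close> only.\<close>

lemma ex_member:
  assumes "U \<noteq> {}" "shuffle ` U \<subseteq> U"
  shows "ex_alg U \<in> members ex_sig (majority_identities 0)"
proof -
  have med: "med x y z \<in> {x, y, z}" for x y z by (auto simp: med_def max_def min_def)
  have "opn (ex_alg U) s xs \<in> U" if "(s, length xs) \<in> ex_sig" "set xs \<subseteq> U" for s xs
    using that(1)
  proof (cases rule: sig_cases)
    case (1 x y z)
    then show ?thesis using med[of x y z] that(2) by auto
  next
    case (2 x)
    then show ?thesis using assms(2) that(2) by auto
  qed
  then have "is_algebra ex_sig (ex_alg U)" using assms(1) by (auto simp: is_algebra_def)
  then show ?thesis
    by (auto simp: members_def majority_identities_def med_def)
qed

text \<open>Monotone maps of chains commute with the median, which leaves \<open>shuffle\<close> to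
  check.\<close>

lemma same_in_Con:
  assumes k: "mono k" and U: "ex_alg U \<in> members ex_sig (majority_identities 0)"
    and u: "\<And>x y. x \<in> U \<Longrightarrow> y \<in> U \<Longrightarrow> k x = k y \<Longrightarrow> k (shuffle x) = k (shuffle y)"
  shows "same U k \<in> Con ex_sig (ex_alg U)"
proof (rule Con_I)
  have alg: "is_algebra ex_sig (ex_alg U)" using U by (simp add: members_def)
  have kmed: "k (med x y z) = med (k x) (k y) (k z)" for x y z
    by (simp add: med_def min_of_mono[OF k] max_of_mono[OF k])
  fix s xs ys
  assume s: "(s, length xs) \<in> ex_sig" and xy: "list_all2 (\<lambda>x y. (x, y) \<in> same U k) xs ys"
  have "set xs \<subseteq> U" "set ys \<subseteq> U"
    using list_all2_in_sets[OF xy, of U] by (auto simp: same_def)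
  then have "opn (ex_alg U) s xs \<in> U" "opn (ex_alg U) s ys \<in> U"
    using is_algebra_opn[OF alg, of s] s list_all2_lengthD[OF xy] by auto
  moreover have "k (opn (ex_alg U) s xs) = k (opn (ex_alg U) s ys)"
    using s xy by (cases rule: sig_cases) (auto simp: list_all2_Cons1 same_def kmed intro: u)
  ultimately show "(opn (ex_alg U) s xs, opn (ex_alg U) s ys) \<in> same U k"
    by (simp add: same_def)
qed (auto simp: same_def)

lemma pullback_same: "U \<subseteq> V \<Longrightarrow> pullback (ex_alg U) id (same V k) = same U k"
  by (auto simp: pullback_def same_def)

section \<open>Congruences on subsets of the chain\<close>

lemma Con_shuffle:
  assumes "\<theta> \<in> Con ex_sig (ex_alg U)" "(x, y) \<in> \<theta>" shows "(shuffle x, shuffle y) \<in> \<theta>"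
  using Con_opn[OF assms(1), of "Suc 0" "[x]" "[y]"] assms(2) by simp

text \<open>For x \<le> z \<le> y the medians of x, z, x and of x, z, y are x and z.\<close>

lemma Con_convex:
  assumes \<theta>: "\<theta> \<in> Con ex_sig (ex_alg U)" and xy: "(x, y) \<in> \<theta>" and z: "z \<in> U" "x \<le> z" "z \<le> y"
  shows "(x, z) \<in> \<theta>" "(z, y) \<in> \<theta>"
proof -
  have "x \<in> U" using xy Con_subset[OF \<theta>] by auto
  then have "(opn (ex_alg U) 0 [x, z, x], opn (ex_alg U) 0 [x, z, y]) \<in> \<theta>"
    using majority_Con[OF \<theta> ex_sig(1)] xy z(1) Con_refl[OF \<theta>] by simp
  moreover have "med x z x = x" "med x z y = z" using z by (auto simp: med_def)
  ultimately show "(x, z) \<in> \<theta>" by simp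
  then show "(z, y) \<in> \<theta>" using xy Con_sym[OF \<theta>] Con_trans[OF \<theta>] by blast
qed

lemma Con_not_subset:
  assumes \<theta>: "\<theta> \<in> Con ex_sig (ex_alg U)" and "\<not> \<theta> \<subseteq> same U k"
  obtains x y where "(x, y) \<in> \<theta>" "k x \<noteq> k y" "x < y" "x \<in> U" "y \<in> U"
proof -
  obtain x y where xy: "(x, y) \<in> \<theta>" "(x, y) \<notin> same U k" using assms(2) by auto
  then have "x \<in> U" "y \<in> U" "k x \<noteq> k y" using Con_subset[OF \<theta>] by (auto simp: same_def)
  then show thesis using that xy(1) Con_sym[OF \<theta> xy(1)] by (metis linorder_neqE_nat)
qed

lemma Lying_Over_not_Going_Up:
  "\<exists>(S :: nat signature) (E :: nat identities) (A :: (nat, nat) algebra) (B :: (nat, nat) algebra)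
      (f :: nat \<Rightarrow> nat).
     is_identities S E \<and> congruence_modular S E \<and> A \<in> members S E \<and> B \<in> members S E \<and>
     admissible S A B f \<and> finitely_generated S B (Nabla B) \<and> fulfills_LO S A B f \<and>
     \<not> fulfills_GU S A B f"
proof -
  let ?E = "majority_identities 0 :: nat identities"
  let ?UA = "{0, 2, 4} :: nat set" and ?UB = "{0, 1, 2, 3, 4} :: nat set"
  let ?A = "ex_alg ?UA" and ?B = "ex_alg ?UB"
  let ?q = "\<lambda>x::nat. x div 4" and ?k = "\<lambda>x::nat. min 3 x"
  have E: "is_identities ex_sig ?E" "congruence_modular ex_sig ?E"
    using is_identities_majority[OF ex_sig(1)] majority_modular_Con[OF _ ex_sig(1)]
    by (auto simp: congruence_modular_def)
  have A: "?A \<in> members ex_sig ?E" and B: "?B \<in> members ex_sig ?E"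
    by (auto intro!: ex_member simp: shuffle_def)
  have algB: "is_algebra ex_sig ?B" and algA: "is_algebra ex_sig ?A"
    using A B by (auto simp: members_def)
  have q: "mono ?q" and k: "mono ?k" by (auto intro!: monoI div_le_mono)
  have CA: "same ?UA id \<in> Con ex_sig ?A" "same ?UA ?q \<in> Con ex_sig ?A"
    by (intro same_in_Con A q; auto simp: shuffle_def mono_def)+
  have CB: "same ?UB ?k \<in> Con ex_sig ?B" "same ?UB ?q \<in> Con ex_sig ?B"
    by (intro same_in_Con B q k; auto simp: shuffle_def)+
  \<comment> \<open>Convexity yields an edge from \<open>x\<close> to \<open>Suc x\<close> with x
    \<le> 2. Its image under \<open>shuffle\<close> is (0, 3), (3, 0) or (0, 2), and each of these
    yields (0, 2).\<close>
  have least_k: "(0, 2) \<in> \<theta>" if \<theta>: "\<theta> \<in> Con ex_sig ?B" and n: "\<not> \<theta> \<subseteq> same ?UB ?k" for \<theta>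
  proof -
    obtain x y where xy: "(x, y) \<in> \<theta>" "?k x \<noteq> ?k y" "x < y" "x \<in> ?UB" "y \<in> ?UB"
      using Con_not_subset[OF \<theta> n] .
    have "(x, Suc x) \<in> \<theta>" using xy by (intro Con_convex[OF \<theta> xy(1)]) auto
    moreover have "x \<in> {0, 1, 2}" using xy by auto
    ultimately have "(0, 3) \<in> \<theta> \<or> (3, 0) \<in> \<theta> \<or> (0, 2) \<in> \<theta>"
      using Con_shuffle[OF \<theta>, of x "Suc x"] by (auto simp: shuffle_def)
    then show ?thesis using Con_convex(1)[OF \<theta>, of 0 3 2] Con_sym[OF \<theta>, of 3 0] by auto
  qed
  have least_q: "(3, 4) \<in> \<theta>" if \<theta>: "\<theta> \<in> Con ex_sig ?B" and n: "\<not> \<theta> \<subseteq> same ?UB ?q" for \<theta>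
  proof -
    obtain x y where xy: "(x, y) \<in> \<theta>" "?q x \<noteq> ?q y" "x < y" "x \<in> ?UB" "y \<in> ?UB"
      using Con_not_subset[OF \<theta> n] .
    then have "y = 4" "x \<le> 3" by auto
    then show ?thesis using Con_convex(2)[OF \<theta> xy(1), of 3] by simp
  qed
  have leastA_id: "(0, 2) \<in> \<theta>" if \<theta>: "\<theta> \<in> Con ex_sig ?A" and n: "\<not> \<theta> \<subseteq> same ?UA id" for \<theta>
  proof -
    obtain x y where xy: "(x, y) \<in> \<theta>" "id x \<noteq> id y" "x < y" "x \<in> ?UA" "y \<in> ?UA"
      using Con_not_subset[OF \<theta> n] .
    then have "(0, 2) \<in> \<theta> \<or> (2, 4) \<in> \<theta>" using Con_convex[OF \<theta> xy(1), of 2] by auto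
    then show ?thesis using Con_shuffle[OF \<theta>, of 2 4] by (auto simp: shuffle_def)
  qed
  have leastA_q: "(2, 4) \<in> \<theta>" if \<theta>: "\<theta> \<in> Con ex_sig ?A" and n: "\<not> \<theta> \<subseteq> same ?UA ?q" for \<theta>
  proof -
    obtain x y where xy: "(x, y) \<in> \<theta>" "?q x \<noteq> ?q y" "x < y" "x \<in> ?UA" "y \<in> ?UA"
      using Con_not_subset[OF \<theta> n] .
    then have "y = 4" "x \<le> 2" by auto
    then show ?thesis using Con_convex(2)[OF \<theta> xy(1), of 2] by simp
  qed
  have SA: "same ?UA id \<in> Spec ex_sig ?A" "same ?UA ?q \<in> Spec ex_sig ?A"
    by (rule Spec_majorityI[OF A ex_sig(1) CA(1) _ _ leastA_id]; simp add: Nabla_def same_def)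
      (rule Spec_majorityI[OF A ex_sig(1) CA(2) _ _ leastA_q]; simp add: Nabla_def same_def)
  have SB: "same ?UB ?k \<in> Spec ex_sig ?B" "same ?UB ?q \<in> Spec ex_sig ?B"
    by (rule Spec_majorityI[OF B ex_sig(1) CB(1) _ _ least_k]; simp add: Nabla_def same_def)
      (rule Spec_majorityI[OF B ex_sig(1) CB(2) _ _ least_q]; simp add: Nabla_def same_def)
  \<comment> \<open>The least pairs found above leave only a three-element chain of congruences,
    whose proper members are prime by \<open>SA\<close>.\<close>
  have ConA: "\<theta> \<in> {same ?UA id, same ?UA ?q, Nabla ?A}" if \<theta>: "\<theta> \<in> Con ex_sig ?A" for \<theta>
  proof -
    have refl: "(0, 0) \<in> \<theta>" "(2, 2) \<in> \<theta>" "(4, 4) \<in> \<theta>" using Con_refl[OF \<theta>] by auto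
    have N: "\<theta> \<subseteq> Nabla ?A" using Con_subset[OF \<theta>] by (simp add: Nabla_def)
    consider "\<theta> \<subseteq> same ?UA id" | "\<theta> \<subseteq> same ?UA ?q" "(0, 2) \<in> \<theta>" | "(0, 2) \<in> \<theta>" "(2, 4) \<in> \<theta>"
      using leastA_id[OF \<theta>] leastA_q[OF \<theta>] by blast
    then show ?thesis
    proof cases
      case 1
      moreover have "same ?UA id \<subseteq> \<theta>" using refl by (auto simp: same_def)
      ultimately show ?thesis by blast
    next
      case 2
      moreover have "same ?UA ?q \<subseteq> \<theta>" using refl 2(2) Con_sym[OF \<theta>] by (auto simp: same_def)
      ultimately show ?thesis by blast
    next
      case 3
      then have "Nabla ?A \<subseteq> \<theta>"
        using refl Con_sym[OF \<theta>] Con_trans[OF \<theta> 3] by (auto simp: Nabla_def)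
      then show ?thesis using N by blast
    qed
  qed
  have SpecA: "Spec ex_sig ?A = {same ?UA id, same ?UA ?q}"
  proof
    show "Spec ex_sig ?A \<subseteq> {same ?UA id, same ?UA ?q}"
      using ConA unfolding Spec_def prime_congruence_def by blast
  qed (use SA in simp)
  have hom: "is_hom ex_sig ?A ?B id" by (auto simp: is_hom_def ex_alg_def)
  have pb: "pullback ?A id (same ?UB ?k) = same ?UA id" "pullback ?A id (same ?UB ?q) = same ?UA ?q"
  proof -
    have "pullback ?A id (same ?UB g) = same ?UA g" for g
      by (rule pullback_same) simp
    \<comment> \<open>On {0, 2, 4} the map \<open>min 3\<close> is injective, so its kernel
      restricts to equality.\<close>
    moreover have "x = y" if "?k x = ?k y" "x \<in> ?UA" "y \<in> ?UA" for x y using that by auto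
    then have "same ?UA ?k = same ?UA id" by (fastforce simp only: same_def id_def)
    ultimately show "pullback ?A id (same ?UB ?k) = same ?UA id"
      "pullback ?A id (same ?UB ?q) = same ?UA ?q" by simp_all
  qed
  \<comment> \<open>Every proper congruence of \<open>?A\<close> is prime, so only properness is at
    stake. The ends 0 and 4 of the chain belong to \<open>?A\<close>, and by convexity a congruence
    of \<open>?B\<close> relating them is full.\<close>
  have "pullback ?A id \<psi> \<in> Spec ex_sig ?A" if "\<psi> \<in> Spec ex_sig ?B" for \<psi>
  proof -
    have \<psi>: "\<psi> \<in> Con ex_sig ?B" "\<psi> \<noteq> Nabla ?B"
      using that by (auto simp: Spec_def prime_congruence_def)
    have "pullback ?A id \<psi> \<noteq> Nabla ?A"
    proof
      assume "pullback ?A id \<psi> = Nabla ?A"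
      moreover have "(0, 4) \<in> Nabla ?A" by (simp add: Nabla_def)
      ultimately have "(0, 4) \<in> pullback ?A id \<psi>" by simp
      then have "(0, 4) \<in> \<psi>" by (simp add: pullback_def)
      then have z: "(0, z) \<in> \<psi>" if "z \<in> ?UB" for z
        by (rule Con_convex(1)[OF \<psi>(1)]) (use that in auto)
      have "\<psi> \<subseteq> Nabla ?B" using Con_subset[OF \<psi>(1)] by (simp only: Nabla_def)
      moreover have "Nabla ?B \<subseteq> \<psi>"
        unfolding Nabla_def univ_ex_alg
        by (rule subrelI) (blast intro: Con_trans[OF \<psi>(1) Con_sym[OF \<psi>(1) z] z])
      ultimately show False using \<psi>(2) by blast
    qed
    then show ?thesis using ConA[OF pullback_in_Con[OF algA hom \<psi>(1)]] SpecA by blast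
  qed
  then have adm: "admissible ex_sig ?A ?B id" using hom by (simp add: admissible_def)
  have fg: "finitely_generated ex_sig ?B (Nabla ?B)"
    unfolding finitely_generated_def
  proof (intro exI conjI)
    \<comment> \<open>The finite relation \<open>Nabla ?B\<close> is chosen as its own generating
      set.\<close>
    show "finite (Nabla ?B)" by (simp add: Nabla_def)
    show "Nabla ?B = Cg ex_sig ?B (Nabla ?B)"
      by (rule antisym[OF Cg_extensive Cg_least[OF Nabla_in_Con[OF algB] order_refl]])
  qed (rule order_refl)
  have LO: "fulfills_LO ex_sig ?A ?B id"
    using SB pb SpecA unfolding fulfills_LO_def by blast
  \<comment> \<open>A lift of the kernel of \<open>x div 4\<close> above that of
    \<open>min 3\<close> would contain (0, 2), then (0, 1) by convexity, (0, 3) by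
    \<open>shuffle\<close>, and (0, 4) through (3, 4); but \<open>x div 4\<close> separates 0 from
    4.\<close>
  have "\<not> fulfills_GU ex_sig ?A ?B id"
  proof
    assume GU: "fulfills_GU ex_sig ?A ?B id"
    have "same ?UA id \<subseteq> same ?UA ?q" by (auto simp: same_def)
    then obtain \<psi> where \<psi>: "\<psi> \<in> Spec ex_sig ?B" "same ?UB ?k \<subseteq> \<psi>"
      "pullback ?A id \<psi> = same ?UA ?q"
      using GU[unfolded fulfills_GU_def, rule_format, OF SA SB(1)] pb(1) by metis
    have C: "\<psi> \<in> Con ex_sig ?B" using \<psi>(1) by (simp add: Spec_def prime_congruence_def)
    have "(0, 2) \<in> same ?UA ?q" by (simp add: same_def)
    then have "(0, 2) \<in> \<psi>" unfolding \<psi>(3)[symmetric] by (simp add: pullback_def)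
    from Con_convex(1)[OF C this, of 1] have "(0, 1) \<in> \<psi>" by simp
    from Con_shuffle[OF C this] have "(0, 3) \<in> \<psi>" by (simp add: shuffle_def)
    moreover have "(3, 4) \<in> same ?UB ?k" by (simp add: same_def)
    then have "(3, 4) \<in> \<psi>" using \<psi>(2) by (rule rev_subsetD)
    ultimately have "(0, 4) \<in> \<psi>" by (rule Con_trans[OF C])
    then have "(0, 4) \<in> pullback ?A id \<psi>" by (simp add: pullback_def)
    then show False using \<psi>(3) by (simp add: same_def)
  qed
  then show ?thesis using E A B adm fg LO by blast
qed

theorem proposition4p23:
  shows
    "(\<forall>(S :: 'f signature) (E :: 'f identities) (A :: ('f, 'a) algebra) (B :: ('f, 'b) algebra)
        (f :: 'a \<Rightarrow> 'b).
        is_identities S E \<and> congruence_modular S E \<and> A \<in> members S E \<and> B \<in> members S E \<and>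
        admissible S A B f \<and> finitely_generated S B (Nabla B) \<and> fulfills_GU S A B f
        \<longrightarrow> fulfills_LO S A B f) \<and>
     (\<exists>(S :: nat signature) (E :: nat identities) (A :: (nat, nat) algebra) (B :: (nat, nat) algebra)
        (f :: nat \<Rightarrow> nat).
        is_identities S E \<and> congruence_modular S E \<and> A \<in> members S E \<and> B \<in> members S E \<and>
        admissible S A B f \<and> finitely_generated S B (Nabla B) \<and> fulfills_LO S A B f \<and>
        \<not> fulfills_GU S A B f)"
  by (intro conjI allI impI Lying_Over_not_Going_Up) (elim conjE, rule GU_imp_LO)

end
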